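(* Let $w$ be a pattern over a finite alphabet $\mathcal{A}$, $\Gamma=(Q,o,F,\alpha,\delta,\gamma)$ a standard and valid $w$-matching machine and $\pi$ a Bernoulli (iid) model on $\mathcal{A}$. The asymptotic speed of $\Gamma$ under $\pi$ is equal to $$\mathrm{AS}_\pi(\Gamma)=\sum_{q\in Q}\alpha_q\,E(q),\qquad E(q)=\frac{\sum_{x:\,\delta(q,x)\neq\odot}\gamma(q,x)\,\pi(x)}{\sum_{x:\,\delta(q,x)\neq\odot}\pi(x)},$$ where $(\alpha_q)_{q\in Q}$ are the limit frequencies of the states of the Markov chain on $Q$ with initial state $o$ and transition probabilities $$\delta_M(q,q')=\frac{\sum_{x:\,\delta(q,x)=q'}\pi(x)}{\sum_{x:\,\delta(q,x)\neq\odot}\pi(x)}.$$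
   Context: Words are finite sequences over $\mathcal{A}$, indexed from $0$; $|v|$ is the length of $v$; the pattern $w$ is nonempty. **Matching machines.** A $w$-matching machine is a 6-tuple $\Gamma=(Q,o,F,\alpha,\delta,\gamma)$: $Q$ a finite set of states, $o\in Q$ the initial state, $F\subset Q$ the pre-match states, $\alpha:Q\to\mathbb{N}$ with $\alpha(q)<|w|$ for all $q\in F$, $\delta:Q\times\mathcal{A}\to Q$, $\gamma:Q\times\mathcal{A}\to\mathbb{N}$. $Q$ always contains a sink state $\odot$ with $\delta(\odot,x)=\odot$ and $\gamma(\odot,x)=0$ for all $x\in\mathcal A$. The order of $\Gamma$ is $O_\Gamma=\max_{q\in Q}\alpha(q)$. **Generic algorithm** on $(\Gamma,t)$, $t$ a word: start with $(q,p)=(o,0)$; while $p\le|t|-|w|$: if $q\in F$ and $t_{p+\alpha(q)}=w_{\alpha(q)}$, report "occurrence at position $p$"; then replace $(q,p)$ by $(\delta(q,t_{p+\alpha(q)}),\,p+\gamma(q,t_{p+\alpha(q)}))$. A symbol $t_j$ with $j\ge|t|$ is read as a fixed letter $a_0\in\mathcal{A}$. $\Gamma$ is *valid* if for every text $t$ the algorithm outputs all, and only, the positions where $w$ occurs in $t$. Standing assumption: every state except possibly the sink is reachable (is the current state at some iteration for some text). **Standard machines.** $R_n$ is the set of partial functions from $\{0,\dots,n\}$ to $\mathcal{A}$, seen as sets of pairs; for $H\in R_n$, $\mathbf f(H)$ is its domain and, for $k\ge0$, the $k$-shifted of $H$ is $\{(u-k,y): (u,y)\in H,\ u\ge k\}$.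 The full memory expansion $\widehat\Gamma$ of $\Gamma$ has states $(q,H)\in Q\times R_{O_\Gamma}$ (and a sink), initial state $(o,\emptyset)$, pre-match states $F\times R_{O_\Gamma}$, next position $\alpha(q)$, shift $\gamma(q,x)$, and transition on $x$ from $(q,H)$: to $(\delta(q,x),H')$ with $H'$ the $\gamma(q,x)$-shifted of $H\cup\{(\alpha(q),x)\}$ if $\alpha(q)\notin\mathbf f(H)$ or $(\alpha(q),x)\in H$; to the sink if $(\alpha(q),a)\in H$ for some $a\ne x$. Unreachable states other than the sink are then removed. $\Gamma$ is *standard* if each non-sink state $q$ of $\Gamma$ appears in exactly one state $(q,H)$ of $\widehat\Gamma$; this $H$ is denoted $\mathbf h_\Gamma(q)$. By convention, in a standard machine, for $q\neq\odot$, $\delta(q,x)=\odot$ exactly when $(\alpha(q),a)\in\mathbf h_\Gamma(q)$ for some $a\ne x$. **Speed and frequencies.** An iid (Bernoulli) model is a probability distribution $\pi$ on $\mathcal{A}$; $\mathrm p_\pi(t)=\prod_{i}\pi(t_i)$. With $a_\Gamma(t)$ the number of iterations (text accesses) of the generic algorithm on $(\Gamma,t)$, $\mathrm{AS}_\pi(\Gamma)=\lim_{n\to\infty}\sum_{t\in\mathcal{A}^n}\frac{|t|}{a_\Gamma(t)}\mathrm p_\pi(t)$. The limit frequency of a state $q$ is $\alpha_q=\lim_{k\to\infty}\frac1k\,\mathbf E\big(\#\{0\le i<k: V_i=q\}\big)$, where $(V_i)$ is the Markov chain (not to be confused with the function $\alpha$ of the machine). Sums and transitions concern non-sink states, and terms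 of states never visited with positive probability (in particular the sink) count as $0$. *)

theory Defs
  imports "HOL-Probability.Probability"
begin

record ('q, 'a) machine =
  states :: "'q set"
  initial :: 'q
  prematch :: "'q set"
  next_pos :: "'q \<Rightarrow> nat"
  trans_fun :: "'q \<Rightarrow> 'a \<Rightarrow> 'q"
  shift_fun :: "'q \<Rightarrow> 'a \<Rightarrow> nat"
  sink :: 'q

definition matching_machine :: "'a list \<Rightarrow> ('q, 'a) machine \<Rightarrow> bool" where
  "matching_machine w \<Gamma> \<longleftrightarrow>
     w \<noteq> [] \<and> finite (states \<Gamma>) \<and> initial \<Gamma> \<in> states \<Gamma> \<and> prematch \<Gamma> \<subseteq> states \<Gamma> \<and>
     (\<forall>q\<in>prematch \<Gamma>. next_pos \<Gamma> q < length w) \<and>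
     (\<forall>q\<in>states \<Gamma>. \<forall>x. trans_fun \<Gamma> q x \<in> states \<Gamma>) \<and>
     sink \<Gamma> \<in> states \<Gamma> \<and>
     (\<forall>x. trans_fun \<Gamma> (sink \<Gamma>) x = sink \<Gamma> \<and> shift_fun \<Gamma> (sink \<Gamma>) x = 0)"

definition machine_order :: "('q, 'a) machine \<Rightarrow> nat" where
  "machine_order \<Gamma> = Max (next_pos \<Gamma> ` states \<Gamma>)"


section \<open>The generic algorithm\<close>

text \<open>The letter \<open>a0\<close> is the one read beyond the end of the text.\<close>

definition text_symbol :: "'a \<Rightarrow> 'a list \<Rightarrow> nat \<Rightarrow> 'a" where
  "text_symbol a0 t j = (if j < length t then t ! j else a0)"

text \<open>The pair \<open>(q, p)\<close> after \<open>i\<close> executions of the loop body, disregarding the loop test.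
  As the second component never decreases, the iterations that really take place are the \<open>i\<close>
  satisfying \<open>loop_test\<close>, which form an initial segment of the natural numbers (all of them if the
  algorithm does not terminate).\<close>

primrec config :: "'a \<Rightarrow> ('q, 'a) machine \<Rightarrow> 'a list \<Rightarrow> nat \<Rightarrow> 'q \<times> nat" where
  "config a0 \<Gamma> t 0 = (initial \<Gamma>, 0)"
| "config a0 \<Gamma> t (Suc i) =
     (let (q, p) = config a0 \<Gamma> t i; x = text_symbol a0 t (p + next_pos \<Gamma> q)
      in (trans_fun \<Gamma> q x, p + shift_fun \<Gamma> q x))"

definition loop_test :: "'a \<Rightarrow> 'a list \<Rightarrow> ('q, 'a) machine \<Rightarrow> 'a list \<Rightarrow> nat \<Rightarrow> bool" where
  "loop_test a0 w \<Gamma> t i \<longleftrightarrow> snd (config a0 \<Gamma> t i) + length w \<le> length t"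

definition reported :: "'a \<Rightarrow> 'a list \<Rightarrow> ('q, 'a) machine \<Rightarrow> 'a list \<Rightarrow> nat set" where
  "reported a0 w \<Gamma> t =
     {p. \<exists>i q. loop_test a0 w \<Gamma> t i \<and> config a0 \<Gamma> t i = (q, p) \<and> q \<in> prematch \<Gamma> \<and>
               text_symbol a0 t (p + next_pos \<Gamma> q) = w ! next_pos \<Gamma> q}"

definition occurrences :: "'a list \<Rightarrow> 'a list \<Rightarrow> nat set" where
  "occurrences w t = {p. p + length w \<le> length t \<and> (\<forall>i<length w. t ! (p + i) = w ! i)}"

definition valid :: "'a \<Rightarrow> 'a list \<Rightarrow> ('q, 'a) machine \<Rightarrow> bool" where
  "valid a0 w \<Gamma> \<longleftrightarrow> (\<forall>t. reported a0 w \<Gamma> t = occurrences w t)"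

definition reachable :: "'a \<Rightarrow> 'a list \<Rightarrow> ('q, 'a) machine \<Rightarrow> 'q \<Rightarrow> bool" where
  "reachable a0 w \<Gamma> q \<longleftrightarrow> (\<exists>t i. loop_test a0 w \<Gamma> t i \<and> fst (config a0 \<Gamma> t i) = q)"

definition all_reachable :: "'a \<Rightarrow> 'a list \<Rightarrow> ('q, 'a) machine \<Rightarrow> bool" where
  "all_reachable a0 w \<Gamma> \<longleftrightarrow> (\<forall>q\<in>states \<Gamma> - {sink \<Gamma>}. reachable a0 w \<Gamma> q)"


section \<open>Full memory expansion and standard machines\<close>

definition partial_funs :: "nat \<Rightarrow> (nat \<times> 'a) set set" where
  "partial_funs n = {H. single_valued H \<and> Domain H \<subseteq> {0..n}}"

definition shifted :: "nat \<Rightarrow> (nat \<times> 'a) set \<Rightarrow> (nat \<times> 'a) set" where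
  "shifted k H = {(u - k, y) |u y. (u, y) \<in> H \<and> u \<ge> k}"

text \<open>The state \<open>None\<close> is the sink of the expansion; its next position is irrelevant.\<close>

definition untrimmed_expansion ::
    "('q, 'a) machine \<Rightarrow> (('q \<times> (nat \<times> 'a) set) option, 'a) machine" where
  "untrimmed_expansion \<Gamma> =
     \<lparr>states = insert None (Some ` (states \<Gamma> \<times> partial_funs (machine_order \<Gamma>))),
      initial = Some (initial \<Gamma>, {}),
      prematch = Some ` (prematch \<Gamma> \<times> partial_funs (machine_order \<Gamma>)),
      next_pos = (\<lambda>s. case s of None \<Rightarrow> 0 | Some (q, H) \<Rightarrow> next_pos \<Gamma> q),
      trans_fun = (\<lambda>s x. case s of None \<Rightarrow> None | Some (q, H) \<Rightarrow>
         if next_pos \<Gamma> q \<notin> Domain H \<or> (next_pos \<Gamma> q, x) \<in> H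
         then Some (trans_fun \<Gamma> q x, shifted (shift_fun \<Gamma> q x) (H \<union> {(next_pos \<Gamma> q, x)}))
         else None),
      shift_fun = (\<lambda>s x. case s of None \<Rightarrow> 0 | Some (q, H) \<Rightarrow> shift_fun \<Gamma> q x),
      sink = None\<rparr>"

definition trim :: "'a \<Rightarrow> 'a list \<Rightarrow> ('q, 'a) machine \<Rightarrow> ('q, 'a) machine" where
  "trim a0 w \<Gamma> =
     (let Q = {q \<in> states \<Gamma>. reachable a0 w \<Gamma> q \<or> q = sink \<Gamma>}
      in \<Gamma>\<lparr>states := Q, prematch := prematch \<Gamma> \<inter> Q\<rparr>)"

definition full_memory_expansion ::
    "'a \<Rightarrow> 'a list \<Rightarrow> ('q, 'a) machine \<Rightarrow> (('q \<times> (nat \<times> 'a) set) option, 'a) machine" where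
  "full_memory_expansion a0 w \<Gamma> = trim a0 w (untrimmed_expansion \<Gamma>)"

definition memory :: "'a \<Rightarrow> 'a list \<Rightarrow> ('q, 'a) machine \<Rightarrow> 'q \<Rightarrow> (nat \<times> 'a) set" where
  "memory a0 w \<Gamma> q = (THE H. Some (q, H) \<in> states (full_memory_expansion a0 w \<Gamma>))"

text \<open>The second conjunct is the usual convention on transitions to the sink.\<close>

definition standard :: "'a \<Rightarrow> 'a list \<Rightarrow> ('q, 'a) machine \<Rightarrow> bool" where
  "standard a0 w \<Gamma> \<longleftrightarrow>
     (\<forall>q\<in>states \<Gamma> - {sink \<Gamma>}. \<exists>!H. Some (q, H) \<in> states (full_memory_expansion a0 w \<Gamma>)) \<and>
     (\<forall>q\<in>states \<Gamma> - {sink \<Gamma>}. \<forall>x.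
        trans_fun \<Gamma> q x = sink \<Gamma> \<longleftrightarrow> (\<exists>a. a \<noteq> x \<and> (next_pos \<Gamma> q, a) \<in> memory a0 w \<Gamma> q))"


section \<open>Asymptotic speed under a Bernoulli model\<close>

definition accesses :: "'a \<Rightarrow> 'a list \<Rightarrow> ('q, 'a) machine \<Rightarrow> 'a list \<Rightarrow> nat" where
  "accesses a0 w \<Gamma> t = card {i. loop_test a0 w \<Gamma> t i}"

definition text_prob :: "'a pmf \<Rightarrow> 'a list \<Rightarrow> real" where
  "text_prob \<pi> t = (\<Prod>i<length t. pmf \<pi> (t ! i))"

definition expected_speed ::
    "'a::finite \<Rightarrow> 'a list \<Rightarrow> ('q, 'a) machine \<Rightarrow> 'a pmf \<Rightarrow> nat \<Rightarrow> real" where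
  "expected_speed a0 w \<Gamma> \<pi> n =
     (\<Sum>t | length t = n. real (length t) / real (accesses a0 w \<Gamma> t) * text_prob \<pi> t)"

definition asymptotic_speed ::
    "'a::finite \<Rightarrow> 'a list \<Rightarrow> ('q, 'a) machine \<Rightarrow> 'a pmf \<Rightarrow> real" where
  "asymptotic_speed a0 w \<Gamma> \<pi> = lim (expected_speed a0 w \<Gamma> \<pi>)"


section \<open>Limit frequencies of a finite Markov chain\<close>

text \<open>The probability that \<open>(V\<^sub>0, \<dots>, V\<^sub>k\<^sub>-\<^sub>1)\<close> is the nonempty list \<open>v\<close>, for a Markov chain \<open>V\<close> with
  initial state \<open>q0\<close> and transition probabilities \<open>P\<close>.\<close>

definition path_prob :: "'q \<Rightarrow> ('q \<Rightarrow> 'q \<Rightarrow> real) \<Rightarrow> 'q list \<Rightarrow> real" where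
  "path_prob q0 P v =
     (if hd v = q0 then \<Prod>i<length v - 1. P (v ! i) (v ! Suc i) else 0)"

text \<open>The expectation of the number of \<open>i < k\<close> with \<open>V\<^sub>i = q\<close>, for a chain on the finite set \<open>S\<close>.\<close>

definition expected_visits ::
    "'q set \<Rightarrow> 'q \<Rightarrow> ('q \<Rightarrow> 'q \<Rightarrow> real) \<Rightarrow> nat \<Rightarrow> 'q \<Rightarrow> real" where
  "expected_visits S q0 P k q =
     (\<Sum>v | length v = k \<and> set v \<subseteq> S. path_prob q0 P v * real (card {i. i < k \<and> v ! i = q}))"

definition mean_visits ::
    "'q set \<Rightarrow> 'q \<Rightarrow> ('q \<Rightarrow> 'q \<Rightarrow> real) \<Rightarrow> 'q \<Rightarrow> nat \<Rightarrow> real" where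
  "mean_visits S q0 P q k = expected_visits S q0 P k q / real k"

definition limit_freq :: "'q set \<Rightarrow> 'q \<Rightarrow> ('q \<Rightarrow> 'q \<Rightarrow> real) \<Rightarrow> 'q \<Rightarrow> real" where
  "limit_freq S q0 P q = lim (mean_visits S q0 P q)"


section \<open>The Markov chain of a standard machine\<close>

text \<open>Both quotients have denominator \<open>0\<close>, hence value \<open>0\<close>, at the sink and possibly at states
  that the chain visits with probability \<open>0\<close>. The function \<open>chain_trans\<close> gives the transition
  probabilities between non-sink states only: the chain lives on \<open>states \<Gamma> - {sink \<Gamma>}\<close>.\<close>

definition chain_trans ::
    "('q, 'a::finite) machine \<Rightarrow> 'a pmf \<Rightarrow> 'q \<Rightarrow> 'q \<Rightarrow> real" where
  "chain_trans \<Gamma> \<pi> q q' =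
     (\<Sum>x | trans_fun \<Gamma> q x = q'. pmf \<pi> x) /
     (\<Sum>x | trans_fun \<Gamma> q x \<noteq> sink \<Gamma>. pmf \<pi> x)"

definition expected_shift :: "('q, 'a::finite) machine \<Rightarrow> 'a pmf \<Rightarrow> 'q \<Rightarrow> real" where
  "expected_shift \<Gamma> \<pi> q =
     (\<Sum>x | trans_fun \<Gamma> q x \<noteq> sink \<Gamma>. real (shift_fun \<Gamma> q x) * pmf \<pi> x) /
     (\<Sum>x | trans_fun \<Gamma> q x \<noteq> sink \<Gamma>. pmf \<pi> x)"

definition chain_mean_visits ::
    "('q, 'a::finite) machine \<Rightarrow> 'a pmf \<Rightarrow> 'q \<Rightarrow> nat \<Rightarrow> real" where
  "chain_mean_visits \<Gamma> \<pi> =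
     mean_visits (states \<Gamma> - {sink \<Gamma>}) (initial \<Gamma>) (chain_trans \<Gamma> \<pi>)"

definition state_freq :: "('q, 'a::finite) machine \<Rightarrow> 'a pmf \<Rightarrow> 'q \<Rightarrow> real" where
  "state_freq \<Gamma> \<pi> =
     limit_freq (states \<Gamma> - {sink \<Gamma>}) (initial \<Gamma>) (chain_trans \<Gamma> \<pi>)"

end

theory Submission
  imports Defs
begin

text \<open>
  A standard machine never reads a letter contradicting its memory, and the memory of its state is
  exactly what is known about the text ahead. Hence a letter access on a random text either is
  independent of the past or has a determined outcome, and the states form a Markov chain with
  kernel \<open>P\<close>. Validity bounds the time spent at one position, so the number of
  iterations on a text of length \<open>n\<close> differs by \<open>O(1)\<close> from the time \<open>\<tau>\<close> at which
  position \<open>n\<close> is approached, and \<open>\<tau>\<close> is between two constant multiples of \<open>n\<close>.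

  Let \<open>f\<close> be the expected shift. The mean ergodic theorem gives \<open>g\<close> with \<open>P g = g\<close> as the limit of
  the averages of \<open>P\<^sup>i f\<close>, and \<open>f - g\<close> is approximated by functions \<open>h - P h\<close>. Up to errors, the
  position at time \<open>\<tau>\<close> is then a martingale, which is \<open>O(\<surd>n)\<close> in \<open>L\<^sup>2\<close>, plus the sum of \<open>g (V\<^sub>i)\<close> over
  \<open>i < \<tau>\<close>. As \<open>g (V\<^sub>i)\<close> is a bounded martingale, it converges in \<open>L\<^sup>2\<close>; its limit may be random when
  there are several recurrent classes, but its expectation is \<open>g o\<close>. This is the limit of the
  expected speed, and also \<open>\<Sum>\<^sub>q \<alpha>\<^sub>q f q\<close>.
\<close>

section \<open>The mean ergodic theorem for finite kernels\<close>

definition kernel_op :: "'q set \<Rightarrow> ('q \<Rightarrow> 'q \<Rightarrow> real) \<Rightarrow> ('q \<Rightarrow> real) \<Rightarrow> 'q \<Rightarrow> real" where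
  "kernel_op S T f q = (\<Sum>q'\<in>S. T q q' * f q')"

lemma kernel_op_cong:
  "(\<And>q'. q' \<in> S \<Longrightarrow> f q' = g q') \<Longrightarrow> kernel_op S T f q = kernel_op S T g q"
  by (simp add: kernel_op_def)

lemma kernel_op_diff:
  "kernel_op S T (\<lambda>q. f q - g q) q = kernel_op S T f q - kernel_op S T g q"
  by (simp add: kernel_op_def right_diff_distrib sum_subtractf)

lemma kernel_op_sum:
  "kernel_op S T (\<lambda>q. \<Sum>i\<in>I. f i q) q = (\<Sum>i\<in>I. kernel_op S T (f i) q)"
  unfolding kernel_op_def sum_distrib_left by (rule sum.swap)

lemma kernel_op_cmult:
  "kernel_op S T (\<lambda>q. c * f q) q = c * kernel_op S T f q"
  by (simp add: kernel_op_def sum_distrib_left mult_ac)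

lemma kernel_op_divide:
  "kernel_op S T (\<lambda>q. f q / c) q = kernel_op S T f q / c"
  by (simp add: kernel_op_def sum_divide_distrib)

abbreviation kernel_pow :: "'q set \<Rightarrow> ('q \<Rightarrow> 'q \<Rightarrow> real) \<Rightarrow> nat \<Rightarrow> ('q \<Rightarrow> real) \<Rightarrow> 'q \<Rightarrow> real" where
  "kernel_pow S T i \<equiv> kernel_op S T ^^ i"

lemma kernel_pow_cong:
  assumes "\<And>q. q \<in> S \<Longrightarrow> f q = g q" "q \<in> S"
  shows "kernel_pow S T i f q = kernel_pow S T i g q"
  using assms(2) by (induction i arbitrary: q) (auto intro: kernel_op_cong simp: assms(1))

lemma kernel_pow_diff:
  "kernel_pow S T i (\<lambda>q. f q - g q) q = kernel_pow S T i f q - kernel_pow S T i g q"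
proof (induction i arbitrary: q)
  case (Suc i)
  then have "kernel_pow S T i (\<lambda>q. f q - g q) =
    (\<lambda>q. kernel_pow S T i f q - kernel_pow S T i g q)" by blast
  then show ?case by (simp add: kernel_op_diff)
qed simp

lemma kernel_pow_sum_cmult:
  "kernel_pow S T i (\<lambda>q. \<Sum>j\<in>J. c j * f j q) q = (\<Sum>j\<in>J. c j * kernel_pow S T i (f j) q)"
proof (induction i arbitrary: q)
  case (Suc i)
  then have "kernel_pow S T i (\<lambda>q. \<Sum>j\<in>J. c j * f j q) =
    (\<lambda>q. \<Sum>j\<in>J. c j * kernel_pow S T i (f j) q)" by blast
  then show ?case by (simp add: kernel_op_sum kernel_op_cmult)
qed simp

lemma kernel_pow_fixed:
  assumes "\<And>q. q \<in> S \<Longrightarrow> kernel_op S T g q = g q" "q \<in> S"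
  shows "kernel_pow S T i g q = g q"
  using assms(2)
proof (induction i arbitrary: q)
  case (Suc i)
  then have "kernel_pow S T (Suc i) g q = kernel_op S T g q"
    by (auto intro: kernel_op_cong)
  then show ?case using assms Suc by simp
qed simp

definition kernel_avg :: "'q set \<Rightarrow> ('q \<Rightarrow> 'q \<Rightarrow> real) \<Rightarrow> ('q \<Rightarrow> real) \<Rightarrow> nat \<Rightarrow> 'q \<Rightarrow> real" where
  "kernel_avg S T f k q = (\<Sum>i<k. kernel_pow S T i f q) / real k"

text \<open>Bolzano-Weierstrass for functions on a finite set, one coordinate at a time: each new
  state refines the subsequence found for the previous ones.\<close>

lemma common_convergent_subseq:
  fixes F :: "nat \<Rightarrow> 'q \<Rightarrow> real"
  assumes "finite S" "\<And>k q. q \<in> S \<Longrightarrow> \<bar>F k q\<bar> \<le> B"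
  shows "\<exists>r g. strict_mono (r :: nat \<Rightarrow> nat) \<and> (\<forall>q\<in>S. (\<lambda>k. F (r k) q) \<longlonglongrightarrow> g q)"
  using assms
proof (induction S rule: finite_induct)
  case empty
  then show ?case by (auto intro: exI[of _ id] simp: strict_mono_def)
next
  case (insert x S)
  then obtain r g where r: "strict_mono (r :: nat \<Rightarrow> nat)"
    and g: "\<forall>q\<in>S. (\<lambda>k. F (r k) q) \<longlonglongrightarrow> g q"
    by auto
  have "bounded (range (\<lambda>k. F (r k) x))"
    using insert.prems by (intro boundedI[where B = B]) auto
  then obtain l r' where r': "strict_mono (r' :: nat \<Rightarrow> nat)"
    and l: "((\<lambda>k. F (r k) x) \<circ> r') \<longlonglongrightarrow> l"
    using bounded_imp_convergent_subsequence by blast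
  have "(\<lambda>k. F ((r \<circ> r') k) q) \<longlonglongrightarrow> (g(x := l)) q" if "q \<in> insert x S" for q
  proof (cases "q = x")
    case True
    then show ?thesis using l by (simp add: o_def)
  next
    case False
    then have "(\<lambda>k. F (r k) q) \<longlonglongrightarrow> g q" using g that by auto
    from LIMSEQ_subseq_LIMSEQ[OF this r'] show ?thesis using False by (simp add: o_def)
  qed
  then show ?case using strict_mono_o[OF r r'] by blast
qed

text \<open>Rows may have mass below 1, because a state whose admissible letters all have
  probability 0 gets a zero row from \<open>chain_trans\<close>.\<close>

locale substochastic_kernel =
  fixes S :: "'q set" and T :: "'q \<Rightarrow> 'q \<Rightarrow> real"
  assumes finite_states: "finite S"
    and nonneg: "\<And>q q'. q \<in> S \<Longrightarrow> q' \<in> S \<Longrightarrow> 0 \<le> T q q'"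
    and row_le_1: "\<And>q. q \<in> S \<Longrightarrow> (\<Sum>q'\<in>S. T q q') \<le> 1"
begin

abbreviation "P \<equiv> kernel_op S T"

lemma abs_kernel_op_le:
  assumes "\<And>q. q \<in> S \<Longrightarrow> \<bar>f q\<bar> \<le> B" "q \<in> S"
  shows "\<bar>P f q\<bar> \<le> B"
proof -
  have "0 \<le> B" using assms by force
  have "\<bar>P f q\<bar> \<le> (\<Sum>q'\<in>S. \<bar>T q q' * f q'\<bar>)"
    unfolding kernel_op_def by (rule sum_abs)
  also have "\<dots> \<le> (\<Sum>q'\<in>S. T q q' * B)"
    using assms nonneg by (intro sum_mono) (simp add: abs_mult mult_left_mono)
  also have "\<dots> = (\<Sum>q'\<in>S. T q q') * B" by (simp add: sum_distrib_right)
  also have "\<dots> \<le> 1 * B" using \<open>0 \<le> B\<close> row_le_1 assms(2) by (intro mult_right_mono)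
  finally show ?thesis by simp
qed

lemma abs_kernel_pow_le:
  assumes "\<And>q. q \<in> S \<Longrightarrow> \<bar>f q\<bar> \<le> B" "q \<in> S"
  shows "\<bar>kernel_pow S T i f q\<bar> \<le> B"
  using assms(2) by (induction i arbitrary: q) (auto intro: abs_kernel_op_le assms(1))

lemma abs_kernel_avg_le:
  assumes "\<And>q. q \<in> S \<Longrightarrow> \<bar>f q\<bar> \<le> B" "q \<in> S"
  shows "\<bar>kernel_avg S T f k q\<bar> \<le> B"
proof (cases "k = 0")
  case True
  then show ?thesis using assms by (force simp: kernel_avg_def)
next
  case False
  have "\<bar>\<Sum>i<k. kernel_pow S T i f q\<bar> \<le> (\<Sum>i<k. B)"
    by (rule order_trans[OF sum_abs sum_mono]) (auto intro: abs_kernel_pow_le assms)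
  then show ?thesis using False by (simp add: kernel_avg_def field_simps)
qed

lemma bounded_on_states: "\<exists>B>0. \<forall>q\<in>S. \<bar>f q :: real\<bar> \<le> B"
proof (intro exI conjI ballI)
  show "0 < (\<Sum>q\<in>S. \<bar>f q\<bar>) + 1"
    by (intro add_nonneg_pos sum_nonneg) auto
  show "\<bar>f q\<bar> \<le> (\<Sum>q\<in>S. \<bar>f q\<bar>) + 1" if "q \<in> S" for q
    using member_le_sum[of q S "\<lambda>q. \<bar>f q\<bar>"] that finite_states by simp
qed

text \<open>The function \<open>h\<close> solves the Poisson equation up to an error \<open>\<epsilon>\<close>; allowing the error avoids
  having to show that the range of \<open>I - P\<close> is closed.\<close>

theorem mean_ergodic:
  obtains g where "\<And>q. q \<in> S \<Longrightarrow> P g q = g q"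
    and "\<And>q. q \<in> S \<Longrightarrow> (\<lambda>k. kernel_avg S T f k q) \<longlonglongrightarrow> g q"
    and "\<And>\<epsilon>. \<epsilon> > 0 \<Longrightarrow> \<exists>h. \<forall>q\<in>S. \<bar>f q - g q - (h q - P h q)\<bar> \<le> \<epsilon>"
proof -
  obtain B where B: "B > 0" "\<And>q. q \<in> S \<Longrightarrow> \<bar>f q\<bar> \<le> B"
    using bounded_on_states[of f] by blast
  obtain r g where r: "strict_mono (r :: nat \<Rightarrow> nat)"
    and g: "\<And>q. q \<in> S \<Longrightarrow> (\<lambda>k. kernel_avg S T f (r k) q) \<longlonglongrightarrow> g q"
    using common_convergent_subseq[OF finite_states, of "kernel_avg S T f", OF abs_kernel_avg_le[OF B(2)]]
    by blast
  have bdd_div: "(\<lambda>k. F k / real k) \<longlonglongrightarrow> 0" if "\<And>k. \<bar>F k\<bar> \<le> C" for F :: "nat \<Rightarrow> real" and C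
  proof (rule Lim_null_comparison)
    show "\<forall>\<^sub>F k in sequentially. norm (F k / real k) \<le> C / real k"
      using that by (intro always_eventually) (simp add: abs_divide divide_right_mono)
  qed (rule lim_const_over_n)
  have fixed: "P g q = g q" if q: "q \<in> S" for q
  proof (rule LIMSEQ_unique)
    show "(\<lambda>k. P (kernel_avg S T f (r k)) q) \<longlonglongrightarrow> P g q"
      unfolding kernel_op_def by (intro tendsto_sum tendsto_mult g tendsto_const)
    \<comment> \<open>Applying \<open>P\<close> shifts the summation index by one, so only the two
      end terms change; divided by \<open>k\<close> they vanish in the limit.\<close>
    have P_avg: "P (kernel_avg S T f k) q =
        kernel_avg S T f k q + (kernel_pow S T k f q - f q) / real k" for k
    proof -
      have "P (kernel_avg S T f k) q = (\<Sum>i<k. kernel_pow S T (Suc i) f q) / real k"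
        unfolding kernel_avg_def[abs_def] kernel_op_divide kernel_op_sum by simp
      also have "(\<Sum>i<k. kernel_pow S T (Suc i) f q) =
          (\<Sum>i<k. kernel_pow S T i f q) + (kernel_pow S T k f q - f q)"
        by (induction k) auto
      finally show ?thesis by (simp add: kernel_avg_def[of S T f k q] add_divide_distrib)
    qed
    have "\<bar>kernel_pow S T k f q - f q\<bar> \<le> 2 * B" for k
      using abs_kernel_pow_le[of f, OF B(2) q, of k] B(2)[OF q] by linarith
    from LIMSEQ_subseq_LIMSEQ[OF bdd_div[OF this] r]
    have "(\<lambda>k. kernel_avg S T f (r k) q + (kernel_pow S T (r k) f q - f q) / real (r k))
      \<longlonglongrightarrow> g q + 0"
      by (intro tendsto_add g q) (simp add: o_def)
    then show "(\<lambda>k. P (kernel_avg S T f (r k)) q) \<longlonglongrightarrow> g q"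
      by (simp add: P_avg)
  qed
  have approx: "\<exists>h. \<forall>q\<in>S. \<bar>f q - g q - (h q - P h q)\<bar> \<le> \<epsilon>" if "\<epsilon> > 0" for \<epsilon>
  proof -
    have "\<forall>\<^sub>F k in sequentially. \<bar>kernel_avg S T f (r k) q - g q\<bar> < \<epsilon>" if "q \<in> S" for q
      using tendstoD[OF g[OF that] \<open>\<epsilon> > 0\<close>] by (simp add: dist_real_def)
    then have "\<forall>\<^sub>F k in sequentially. \<forall>q\<in>S. \<bar>kernel_avg S T f (r k) q - g q\<bar> < \<epsilon>"
      using finite_states by (simp add: eventually_ball_finite_distrib)
    moreover have "\<forall>\<^sub>F k in sequentially. 0 < k" by (rule eventually_gt_at_top)
    ultimately have "\<forall>\<^sub>F k in sequentially. 0 < k \<and> (\<forall>q\<in>S. \<bar>kernel_avg S T f (r k) q - g q\<bar> < \<epsilon>)"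
      by eventually_elim auto
    then obtain k0 where k0: "0 < k0" "\<And>q. q \<in> S \<Longrightarrow> \<bar>kernel_avg S T f (r k0) q - g q\<bar> < \<epsilon>"
      by (auto dest: eventually_happens)
    define k where "k = r k0"
    have k: "k > 0" using k0(1) seq_suble[OF r, of k0] by (simp add: k_def)
    \<comment> \<open>Averaging the partial sums of the powers of \<open>P\<close> on
      \<open>f\<close> makes \<open>h - P h\<close> telescope to \<open>f\<close> minus its
      \<open>k\<close>-th average, and \<open>k\<close> was chosen so that this average is within
      \<epsilon> of \<open>g\<close>.\<close>
    define h where "h q = (\<Sum>i<k. \<Sum>j<i. kernel_pow S T j f q) / real k" for q
    have "h q - P h q = f q - kernel_avg S T f k q" if "q \<in> S" for q
    proof -
      have "P h q = (\<Sum>i<k. \<Sum>j<i. kernel_pow S T (Suc j) f q) / real k"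
        unfolding h_def[abs_def] kernel_op_divide kernel_op_sum by simp
      then have "h q - P h q =
          (\<Sum>i<k. \<Sum>j<i. kernel_pow S T j f q - kernel_pow S T (Suc j) f q) / real k"
        by (simp add: h_def sum_subtractf diff_divide_distrib)
      also have "\<dots> = (\<Sum>i<k. f q - kernel_pow S T i f q) / real k"
        using sum_lessThan_telescope'[of "\<lambda>j. kernel_pow S T j f q"] by simp
      also have "\<dots> = f q - kernel_avg S T f k q"
        using k by (simp add: kernel_avg_def sum_subtractf diff_divide_distrib)
      finally show ?thesis .
    qed
    then have "\<forall>q\<in>S. \<bar>f q - g q - (h q - P h q)\<bar> \<le> \<epsilon>"
      using k0(2) by (fastforce simp: k_def)
    then show ?thesis by blast
  qed
  \<comment> \<open>Passage from the subsequence to all \<open>k\<close>. Write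
    \<open>f = g + (h - P h) + u\<close> with \<open>u\<close> at most \<open>e / 2\<close> in
    absolute value: the averages of \<open>g\<close> are constant, those of \<open>h - P h\<close>
    are O(1/k), and those of \<open>u\<close> stay within \<open>e / 2\<close>.\<close>
  have "(\<lambda>k. kernel_avg S T f k q) \<longlonglongrightarrow> g q" if q: "q \<in> S" for q
  proof (rule tendstoI)
    fix e :: real
    assume "e > 0"
    then obtain h where h: "\<And>q. q \<in> S \<Longrightarrow> \<bar>f q - g q - (h q - P h q)\<bar> \<le> e / 2"
      using approx[of "e / 2"] by auto
    define u where "u q = f q - g q - (h q - P h q)" for q
    obtain C where C: "\<And>q. q \<in> S \<Longrightarrow> \<bar>h q\<bar> \<le> C"
      using bounded_on_states[of h] by blast
    have pow_u: "kernel_pow S T i u q = kernel_pow S T i f q - g q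
        - (kernel_pow S T i h q - kernel_pow S T (Suc i) h q)" for i
      unfolding u_def[abs_def]
      by (simp only: kernel_pow_diff kernel_pow_fixed[OF fixed q] funpow_Suc_right o_def)
    have "\<bar>kernel_pow S T k h q - h q\<bar> \<le> 2 * C" for k
      using abs_kernel_pow_le[of h, OF C q, of k] C[OF q] by linarith
    from tendstoD[OF bdd_div[OF this], of "e / 2"] \<open>e > 0\<close>
    have "\<forall>\<^sub>F k in sequentially. \<bar>(kernel_pow S T k h q - h q) / real k\<bar> < e / 2"
      by (simp add: dist_real_def)
    moreover have "\<forall>\<^sub>F k in sequentially. 0 < k" by (rule eventually_gt_at_top)
    ultimately show "\<forall>\<^sub>F k in sequentially. dist (kernel_avg S T f k q) (g q) < e"
    proof eventually_elim
      case (elim k)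
      have "(\<Sum>i<k. kernel_pow S T i u q) = (\<Sum>i<k. kernel_pow S T i f q) - real k * g q
          + (kernel_pow S T k h q - h q)"
        by (induction k) (auto simp: pow_u algebra_simps)
      then have "kernel_avg S T u k q =
          kernel_avg S T f k q - g q + (kernel_pow S T k h q - h q) / real k"
        using elim by (simp add: kernel_avg_def add_divide_distrib diff_divide_distrib)
      moreover have "\<bar>kernel_avg S T u k q\<bar> \<le> e / 2"
        using h by (intro abs_kernel_avg_le q) (simp add: u_def)
      ultimately show ?case using elim unfolding dist_real_def by linarith
    qed
  qed
  from fixed this approx show ?thesis by (rule that)
qed

lemma kernel_avg_convergent:
  assumes "q \<in> S"
  shows "convergent (\<lambda>k. kernel_avg S T f k q)"
proof (rule mean_ergodic[of f])
  fix g
  assume "\<And>q. q \<in> S \<Longrightarrow> (\<lambda>k. kernel_avg S T f k q) \<longlonglongrightarrow> g q"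
  from this[OF assms] show ?thesis by (rule convergentI)
qed

end

section \<open>Runs of a valid standard machine\<close>

text \<open>The algorithm on an infinite text and without the loop test: finite texts padded with
  \<open>a0\<close> and random texts then obey the same recursion.\<close>

primrec run :: "('q, 'a) machine \<Rightarrow> (nat \<Rightarrow> 'a) \<Rightarrow> nat \<Rightarrow> 'q \<times> nat" where
  "run \<Gamma> s 0 = (initial \<Gamma>, 0)"
| "run \<Gamma> s (Suc i) =
     (let (q, p) = run \<Gamma> s i; x = s (p + next_pos \<Gamma> q)
      in (trans_fun \<Gamma> q x, p + shift_fun \<Gamma> q x))"

lemma config_eq_run: "config a0 \<Gamma> t i = run \<Gamma> (text_symbol a0 t) i"
  by (induction i) simp_all

locale valid_standard_machine =
  fixes w :: "'a::finite list" and a0 :: 'a and \<Gamma> :: "('q, 'a) machine"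
  assumes machine: "matching_machine w \<Gamma>"
    and standard: "standard a0 w \<Gamma>"
    and valid: "valid a0 w \<Gamma>"
begin

definition "st s i = fst (run \<Gamma> s i)"
definition "pos s i = snd (run \<Gamma> s i)"
definition "access s i = pos s i + next_pos \<Gamma> (st s i)"
definition "letter s i = s (access s i)"

lemma run_eq: "run \<Gamma> s i = (st s i, pos s i)"
  by (simp add: st_def pos_def)

lemma st_0 [simp]: "st s 0 = initial \<Gamma>"
  and pos_0 [simp]: "pos s 0 = 0"
  by (simp_all add: st_def pos_def)

lemma st_Suc [simp]: "st s (Suc i) = trans_fun \<Gamma> (st s i) (letter s i)"
  and pos_Suc [simp]: "pos s (Suc i) = pos s i + shift_fun \<Gamma> (st s i) (letter s i)"
  by (simp_all add: st_def pos_def letter_def access_def Let_def split: prod.splits)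

lemma finite_states: "finite (states \<Gamma>)"
  and initial_in: "initial \<Gamma> \<in> states \<Gamma>"
  and trans_in: "q \<in> states \<Gamma> \<Longrightarrow> trans_fun \<Gamma> q x \<in> states \<Gamma>"
  and trans_sink: "trans_fun \<Gamma> (sink \<Gamma>) x = sink \<Gamma>"
  and shift_sink: "shift_fun \<Gamma> (sink \<Gamma>) x = 0"
  and w_nonempty: "w \<noteq> []"
  using machine by (auto simp: matching_machine_def)

lemma st_in: "st s i \<in> states \<Gamma>"
  by (induction i) (auto simp: initial_in trans_in)

lemma next_pos_le: "q \<in> states \<Gamma> \<Longrightarrow> next_pos \<Gamma> q \<le> machine_order \<Gamma>"
  unfolding machine_order_def by (intro Max_ge) (auto simp: finite_states)

lemma access_le: "access s i \<le> pos s i + machine_order \<Gamma>"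
  by (simp add: access_def next_pos_le st_in)

definition "max_shift = (\<Sum>q\<in>states \<Gamma>. \<Sum>x\<in>UNIV. shift_fun \<Gamma> q x)"

lemma shift_le: "q \<in> states \<Gamma> \<Longrightarrow> shift_fun \<Gamma> q x \<le> max_shift"
  unfolding max_shift_def
  using member_le_sum[of x UNIV "shift_fun \<Gamma> q"]
    member_le_sum[of q "states \<Gamma>" "\<lambda>q. \<Sum>x\<in>UNIV. shift_fun \<Gamma> q x"]
  by (simp add: finite_states)

lemma pos_le: "pos s i \<le> max_shift * i"
proof (induction i)
  case (Suc i)
  then show ?case using shift_le[OF st_in[of s i], of "letter s i"] by simp
qed simp

lemma mono_pos: "mono (pos s)"
  by (simp add: mono_iff_le_Suc)

lemmas pos_mono = monoD[OF mono_pos]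

text \<open>The hypothesis concerns only the positions read on \<open>s\<close>: by induction the
  run on \<open>s'\<close> reads the same ones. This allows a text to be altered away from the
  accesses.\<close>

lemma run_cong:
  assumes "\<And>j. j < i \<Longrightarrow> s' (access s j) = s (access s j)"
  shows "st s' i = st s i \<and> pos s' i = pos s i"
  using assms
proof (induction i)
  case (Suc i)
  then show ?case by (simp add: access_def letter_def)
qed simp

lemma history_cong:
  assumes "\<And>j. j < i \<Longrightarrow> s' (access s j) = s (access s j)"
  shows "j \<le> i \<Longrightarrow> st s' j = st s j" "j \<le> i \<Longrightarrow> pos s' j = pos s j"
    "j \<le> i \<Longrightarrow> access s' j = access s j" "j < i \<Longrightarrow> letter s' j = letter s j"
  using run_cong[of j s' s] assms by (auto simp: access_def letter_def)

section \<open>Linear progress of the position\<close>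

lemma eventually_periodic:
  assumes "st s a = st s b" "pos s a = pos s b"
  shows "st s (a + k) = st s (b + k) \<and> pos s (a + k) + pos s b = pos s (b + k) + pos s a"
  using assms by (induction k) (auto simp: access_def letter_def)

text \<open>If the position stayed constant for \<open>card (states \<Gamma>)\<close> steps, the machine would loop at that
  position forever, and would miss an occurrence of \<open>w\<close> written beyond the letters read.\<close>

lemma pos_progress: "pos s i < pos s (i + card (states \<Gamma>))"
proof (rule ccontr)
  let ?n = "card (states \<Gamma>)" and ?p = "pos s i"
  assume "\<not> ?thesis"
  then have eq: "pos s (i + ?n) = ?p"
    using pos_mono[of i "i + ?n" s] by simp
  have const: "pos s j = ?p" if "i \<le> j" "j \<le> i + ?n" for j
    using pos_mono[OF that(1), of s] pos_mono[OF that(2), of s] eq by simp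
  have "\<not> inj_on (st s) {i..i + ?n}"
  proof
    assume "inj_on (st s) {i..i + ?n}"
    then have "card {i..i + ?n} \<le> ?n"
      by (rule card_inj_on_le) (auto simp: st_in finite_states)
    then show False by simp
  qed
  then obtain a b where ab: "i \<le> a" "a < b" "b \<le> i + ?n" "st s a = st s b"
    unfolding inj_on_def by (metis atLeastAtMost_iff linorder_neqE_nat)
  then have pab: "pos s a = ?p" "pos s b = ?p" by (auto intro: const)
  \<comment> \<open>Between \<open>a\<close> and \<open>b\<close> the run closes a cycle, so any
    later time can be pulled back by the period \<open>b - a\<close>.\<close>
  have stuck: "pos s j \<le> ?p" for j
  proof (induction j rule: less_induct)
    case (less j)
    show ?case
    proof (cases "j \<le> b")
      case True
      then show ?thesis using pos_mono[of j b s] pab by simp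
    next
      case False
      then have "pos s (a + (j - b)) = pos s j"
        using eventually_periodic[OF ab(4), of "j - b"] pab by simp
      moreover have "pos s (a + (j - b)) \<le> ?p"
        using False ab by (intro less) auto
      ultimately show ?thesis by simp
    qed
  qed
  \<comment> \<open>All accesses lie below \<open>m\<close>, so writing \<open>w\<close> at
    \<open>m\<close> leaves the run unchanged, and the occurrence at \<open>m\<close> is never
    reported.\<close>
  define m where "m = ?p + machine_order \<Gamma> + 1"
  define t where "t = map s [0..<m] @ w"
  have "text_symbol a0 t u = s u" if "u < m" for u
    using that by (simp add: text_symbol_def t_def nth_append)
  moreover have "access s j < m" for j
    using access_le[of s j] stuck[of j] by (simp add: m_def)
  ultimately have "pos (text_symbol a0 t) j = pos s j" for j
    using run_cong[of j "text_symbol a0 t" s] by simp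
  then have "reported a0 w \<Gamma> t \<subseteq> {..?p}"
    using stuck by (force simp: reported_def config_eq_run run_eq)
  moreover have "m \<in> occurrences w t"
    by (auto simp: occurrences_def t_def nth_append)
  moreover have "?p < m" by (simp add: m_def)
  ultimately show False using valid by (auto simp: valid_def)
qed

lemma pos_add_mult: "pos s i + m \<le> pos s (i + m * card (states \<Gamma>))"
proof (induction m)
  case (Suc m)
  then show ?case
    using pos_progress[of s "i + m * card (states \<Gamma>)"] by (simp add: add_ac)
qed simp

text \<open>At the sink the position would never move, contrary to
  \<open>pos_progress\<close>.\<close>

lemma initial_not_sink: "initial \<Gamma> \<noteq> sink \<Gamma>"
proof
  assume "initial \<Gamma> = sink \<Gamma>"
  then have "st s i = sink \<Gamma> \<and> pos s i = 0" for s i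
    by (induction i) (auto simp: trans_sink shift_sink)
  then show False using pos_progress[of "\<lambda>_. a0" 0] by simp
qed

text \<open>The memory that the full memory expansion carries along the run, in closed form: letters
  already read, indexed relative to the current position, without those left behind. The link is
  made in \<open>run_expansion\<close>.\<close>

definition known :: "(nat \<Rightarrow> 'a) \<Rightarrow> nat \<Rightarrow> (nat \<times> 'a) set" where
  "known s i = {(access s j - pos s i, letter s j) | j. j < i \<and> pos s i \<le> access s j}"

lemma knownD: "(u, y) \<in> known s i \<Longrightarrow> y = s (pos s i + u)"
  by (auto simp: known_def letter_def)

text \<open>The position about to be read is never behind the current one, so an earlier access to
  it has not been dropped from the memory.\<close>

lemma next_known_iff:
  "(next_pos \<Gamma> (st s i), y) \<in> known s i \<longleftrightarrow> access s i \<in> access s ` {..<i} \<and> y = letter s i"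
proof
  assume "(next_pos \<Gamma> (st s i), y) \<in> known s i"
  then obtain j where j: "j < i" "pos s i \<le> access s j" "y = letter s j"
      "next_pos \<Gamma> (st s i) = access s j - pos s i"
    by (auto simp: known_def)
  then have "access s i = access s j" by (simp add: access_def[of s i])
  with j show "access s i \<in> access s ` {..<i} \<and> y = letter s i"
    by (simp add: letter_def)
next
  assume "access s i \<in> access s ` {..<i} \<and> y = letter s i"
  then obtain j where j: "j < i" "access s j = access s i" "y = letter s i" by force
  then show "(next_pos \<Gamma> (st s i), y) \<in> known s i"
    unfolding known_def by (intro CollectI exI[of _ j]) (simp add: letter_def access_def[of s i])
qed

lemma shifted_known:
  "shifted (shift_fun \<Gamma> (st s i) (letter s i)) (known s i \<union> {(next_pos \<Gamma> (st s i), letter s i)})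
     = known s (Suc i)"
proof -
  define k where "k = shift_fun \<Gamma> (st s i) (letter s i)"
  have "known s i \<union> {(next_pos \<Gamma> (st s i), letter s i)} =
      {(access s j - pos s i, letter s j) | j. j < Suc i \<and> pos s i \<le> access s j}"
    unfolding known_def by (safe; force simp: less_Suc_eq access_def[of s i])
  moreover have "shifted k \<dots> = {(access s j - (pos s i + k), letter s j) | j.
      j < Suc i \<and> pos s i + k \<le> access s j}"
    (is "_ = ?B")
  proof (intro equalityI subsetI)
    fix z
    assume "z \<in> ?B"
    then obtain j where j: "z = (access s j - pos s i - k, letter s j)" "j < Suc i"
        "pos s i + k \<le> access s j"
      by auto
    then have "k \<le> access s j - pos s i" "pos s i \<le> access s j" by auto
    with j show "z \<in> shifted k {(access s j - pos s i, letter s j) | j.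
        j < Suc i \<and> pos s i \<le> access s j}"
      unfolding shifted_def by blast
  qed (auto simp: shifted_def)
  ultimately show ?thesis by (simp add: k_def[symmetric] known_def)
qed

lemma known_partial_fun: "known s i \<in> partial_funs (machine_order \<Gamma>)"
proof -
  have "u \<le> machine_order \<Gamma>" if "(u, y) \<in> known s i" for u y
  proof -
    from that obtain j where "j < i" "u = access s j - pos s i" by (auto simp: known_def)
    then show ?thesis using access_le[of s j] pos_mono[of j i s] by linarith
  qed
  then show ?thesis
    by (auto simp: partial_funs_def single_valued_def dest: knownD)
qed

text \<open>The memory holds letters of the text itself, so it never contradicts the letter being
  read and the expansion does not fall into its sink.\<close>

lemma run_expansion: "run (untrimmed_expansion \<Gamma>) s i = (Some (st s i, known s i), pos s i)"
proof (induction i)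
  case 0
  then show ?case by (simp add: untrimmed_expansion_def known_def)
next
  case (Suc i)
  have "next_pos \<Gamma> (st s i) \<notin> Domain (known s i) \<or>
      (next_pos \<Gamma> (st s i), letter s i) \<in> known s i"
    by (auto simp: letter_def access_def dest: knownD)
  then show ?case
    using Suc shifted_known[of s i]
    by (auto simp: untrimmed_expansion_def Let_def access_def[symmetric] letter_def[symmetric])
qed

text \<open>Standardness makes the memory of a state unique, so it suffices to show that one
  expanded state over \<open>st s i\<close>, the one with memory \<open>known s i\<close>, is
  reachable.\<close>

lemma memory_st:
  assumes "st s i \<noteq> sink \<Gamma>"
  shows "memory a0 w \<Gamma> (st s i) = known s i"
proof -
  \<comment> \<open>Reachability refers to finite texts: \<open>n\<close> is large enough to contain
    the first \<open>i\<close> accesses and to let the loop test succeed at step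
    \<open>i\<close>.\<close>
  define n where "n = pos s i + machine_order \<Gamma> + length w + 1"
  define t where "t = map s [0..<n]"
  let ?s = "text_symbol a0 t"
  have "?s (access s j) = s (access s j)" if "j < i" for j
    using access_le[of s j] pos_mono[of j i s] that
    by (simp add: text_symbol_def t_def n_def del: upt_Suc)
  from history_cong[of i ?s, OF this]
  have eq: "st ?s i = st s i" "pos ?s i = pos s i" "known ?s i = known s i"
    by (auto simp: known_def intro!: Collect_cong ex_cong1)
  have "reachable a0 w (untrimmed_expansion \<Gamma>) (Some (st s i, known s i))"
    unfolding reachable_def loop_test_def config_eq_run run_expansion
    using eq by (intro exI[of _ t] exI[of _ i]) (simp add: t_def n_def)
  then have "Some (st s i, known s i) \<in> states (full_memory_expansion a0 w \<Gamma>)"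
    using st_in[of s i] known_partial_fun[of s i]
    by (simp add: full_memory_expansion_def trim_def Let_def untrimmed_expansion_def)
  moreover have "\<exists>!H. Some (st s i, H) \<in> states (full_memory_expansion a0 w \<Gamma>)"
    using st_in assms by (intro conjunct1[OF standard[unfolded standard_def], THEN bspec]) simp
  ultimately show ?thesis
    unfolding memory_def by (rule the1_equality[rotated])
qed

text \<open>The convention on sink transitions, read along a run through \<open>memory_st\<close>.
  At a fresh access no letter leads to the sink; at a repeated one all letters do except the one in
  the text.\<close>

lemma trans_st_eq_sink_iff:
  assumes "st s i \<noteq> sink \<Gamma>"
  shows "trans_fun \<Gamma> (st s i) x = sink \<Gamma> \<longleftrightarrow>
    access s i \<in> access s ` {..<i} \<and> x \<noteq> letter s i"
proof -
  have "st s i \<in> states \<Gamma> - {sink \<Gamma>}" using st_in assms by simp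
  from conjunct2[OF standard[unfolded standard_def], THEN bspec, OF this, THEN spec, of x]
  show ?thesis by (auto simp: memory_st[OF assms] next_known_iff)
qed

lemma st_not_sink: "st s i \<noteq> sink \<Gamma>"
proof (induction i)
  case (Suc i)
  show ?case using trans_st_eq_sink_iff[OF Suc, of "letter s i"] by simp
qed (simp add: initial_not_sink)

end

section \<open>Random texts\<close>

context valid_standard_machine
begin

text \<open>This generates the filtration of the process: by \<open>letters_determine_run\<close>
  the letters read fix states, positions and accesses.\<close>

definition "hist s i = map (letter s) [0..<i]"

lemma length_hist [simp]: "length (hist s i) = i"
  by (simp add: hist_def)

lemma hist_eq_iff_letter: "hist s i = hist s' i \<longleftrightarrow> (\<forall>j<i. letter s j = letter s' j)"
  by (auto simp: hist_def)

lemma letters_determine_run: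
  assumes "\<And>j. j < i \<Longrightarrow> letter s j = letter s' j"
  shows "st s i = st s' i \<and> pos s i = pos s' i"
  using assms by (induction i) auto

lemma hist_determines:
  assumes "hist s i = hist s' i"
  shows "j \<le> i \<Longrightarrow> st s j = st s' j" "j \<le> i \<Longrightarrow> pos s j = pos s' j"
    "j \<le> i \<Longrightarrow> access s j = access s' j" "j < i \<Longrightarrow> letter s j = letter s' j"
  using letters_determine_run[of j s s'] assms by (auto simp: hist_eq_iff_letter access_def)

text \<open>The accessed positions depend on the text, but on this event they are those of
  \<open>s0\<close>. A prescribed history is therefore a cylinder event, whose probability is a
  product.\<close>

lemma hist_eq_iff:
  "hist s i = hist s0 i \<longleftrightarrow> (\<forall>u\<in>access s0 ` {..<i}. s u = s0 u)"
proof
  assume h: "hist s i = hist s0 i"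
  show "\<forall>u\<in>access s0 ` {..<i}. s u = s0 u"
  proof (clarify)
    fix j
    assume "j < i"
    then show "s (access s0 j) = s0 (access s0 j)"
      using hist_determines(3,4)[OF h, of j] by (simp add: letter_def)
  qed
next
  assume "\<forall>u\<in>access s0 ` {..<i}. s u = s0 u"
  then show "hist s i = hist s0 i"
    using history_cong(4)[of i s s0] by (simp add: hist_eq_iff_letter)
qed

definition adapted :: "nat \<Rightarrow> ((nat \<Rightarrow> 'a) \<Rightarrow> 'b) \<Rightarrow> bool" where
  "adapted i \<Phi> \<longleftrightarrow> (\<forall>s s'. hist s i = hist s' i \<longrightarrow> \<Phi> s = \<Phi> s')"

lemma adaptedI:
  "(\<And>s s'. hist s i = hist s' i \<Longrightarrow> \<Phi> s = \<Phi> s') \<Longrightarrow> adapted i \<Phi>"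
  unfolding adapted_def by blast

lemma adaptedD: "adapted i \<Phi> \<Longrightarrow> hist s i = hist s' i \<Longrightarrow> \<Phi> s = \<Phi> s'"
  unfolding adapted_def by blast

text \<open>A bound, uniform in the text, on the positions read up to step \<open>i\<close>. On a
  random text longer than this, none of these letters is padding.\<close>

definition "horizon i = max_shift * i + machine_order \<Gamma>"

lemma horizon_mono: "i \<le> j \<Longrightarrow> horizon i \<le> horizon j"
  by (simp add: horizon_def)

lemma access_le_horizon: "j \<le> i \<Longrightarrow> access s j \<le> horizon i"
  using access_le[of s j] pos_le[of s j] horizon_mono[of j i] unfolding horizon_def by linarith

end

section \<open>The law of the letters read\<close>

locale bernoulli_machine = valid_standard_machine w a0 \<Gamma>
  for w :: "'a::finite list" and a0 :: 'a and \<Gamma> :: "('q, 'a) machine" +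
  fixes \<pi> :: "'a pmf"
begin

text \<open>Random texts of length \<open>L\<close>, as functions with the value \<open>a0\<close> beyond \<open>L\<close>.\<close>

definition texts :: "nat \<Rightarrow> (nat \<Rightarrow> 'a) pmf" where
  "texts L = Pi_pmf {..<L} a0 (\<lambda>_. \<pi>)"

abbreviation E :: "nat \<Rightarrow> ((nat \<Rightarrow> 'a) \<Rightarrow> real) \<Rightarrow> real" where
  "E L \<equiv> measure_pmf.expectation (texts L)"

lemma finite_texts: "finite (set_pmf (texts L))"
  unfolding texts_def by (subst set_Pi_pmf) auto

lemma integrable_texts [simp]: "integrable (measure_pmf (texts L)) (F :: (nat \<Rightarrow> 'a) \<Rightarrow> real)"
  by (rule integrable_measure_pmf_finite[OF finite_texts])

lemma E_mono: "(\<And>s. F s \<le> G s) \<Longrightarrow> E L F \<le> E L G"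
  by (rule integral_mono) auto

lemma abs_E_le: "\<bar>E L F\<bar> \<le> E L (\<lambda>s. \<bar>F s\<bar>)"
  by (rule integral_abs_bound)

text \<open>Nonnegativity of the variance of the absolute value of \<open>F\<close>. It turns L2
  bounds on martingales into L1 bounds.\<close>

lemma E_abs_le_sqrt: "E L (\<lambda>s. \<bar>F s\<bar>) \<le> sqrt (E L (\<lambda>s. (F s)\<^sup>2))"
proof (rule real_le_rsqrt)
  have "0 \<le> measure_pmf.variance (texts L) (\<lambda>s. \<bar>F s\<bar>)"
    by (rule measure_pmf.variance_positive)
  also have "\<dots> = E L (\<lambda>s. (F s)\<^sup>2) - (E L (\<lambda>s. \<bar>F s\<bar>))\<^sup>2"
    by (subst measure_pmf.variance_eq) simp_all
  finally show "(E L (\<lambda>s. \<bar>F s\<bar>))\<^sup>2 \<le> E L (\<lambda>s. (F s)\<^sup>2)" by simp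
qed

lemma E_by_values:
  assumes "finite A" "\<And>s. Y s \<in> A"
  shows "E L (\<lambda>s. G (Y s)) = (\<Sum>y\<in>A. G y * measure_pmf.prob (texts L) {s. Y s = y})"
proof -
  have "E L (\<lambda>s. G (Y s)) = measure_pmf.expectation (map_pmf Y (texts L)) G"
    by simp
  also have "\<dots> = (\<Sum>y\<in>A. G y * pmf (map_pmf Y (texts L)) y)"
    using assms by (intro integral_measure_pmf_real) auto
  finally show ?thesis by (simp add: pmf_map vimage_def)
qed

lemma prob_cylinder:
  assumes "D \<subseteq> {..<L}"
  shows "measure_pmf.prob (texts L) {s. \<forall>u\<in>D. s u = s0 u} = (\<Prod>u\<in>D. pmf \<pi> (s0 u))"
proof -
  let ?B = "\<lambda>u. if u \<in> D then {s0 u} else UNIV"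
  have "{s. \<forall>u\<in>D. s u = s0 u} = Pi {..<L} ?B"
    using assms by (auto simp: Pi_def)
  then have "measure_pmf.prob (texts L) {s. \<forall>u\<in>D. s u = s0 u} =
      (\<Prod>u<L. measure_pmf.prob \<pi> (?B u))"
    by (simp add: texts_def measure_Pi_pmf_Pi)
  also have "\<dots> = (\<Prod>u\<in>D. measure_pmf.prob \<pi> (?B u))"
    using assms by (intro prod.mono_neutral_right) auto
  also have "\<dots> = (\<Prod>u\<in>D. pmf \<pi> (s0 u))"
    by (intro prod.cong) (simp_all add: measure_pmf_single)
  finally show ?thesis .
qed

text \<open>The denominator shared by \<open>chain_trans\<close> and
  \<open>expected_shift\<close>.\<close>

definition "live q = (\<Sum>x | trans_fun \<Gamma> q x \<noteq> sink \<Gamma>. pmf \<pi> x)"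

text \<open>Meant as the conditional law of the letter read in state \<open>q\<close> given the
  history; it is identically 0 when \<open>live q\<close> is 0.\<close>

definition letter_prob :: "'q \<Rightarrow> 'a \<Rightarrow> real" where
  "letter_prob q x = (if trans_fun \<Gamma> q x \<noteq> sink \<Gamma> then pmf \<pi> x / live q else 0)"

lemma sum_letter_prob_mult:
  "(\<Sum>x\<in>UNIV. letter_prob q x * f x) = (\<Sum>x | trans_fun \<Gamma> q x \<noteq> sink \<Gamma>. pmf \<pi> x * f x) / live q"
proof -
  have "(\<Sum>x\<in>UNIV. letter_prob q x * f x) =
      (\<Sum>x | trans_fun \<Gamma> q x \<noteq> sink \<Gamma>. letter_prob q x * f x)"
    by (intro sum.mono_neutral_right) (auto simp: letter_prob_def)
  also have "\<dots> = (\<Sum>x | trans_fun \<Gamma> q x \<noteq> sink \<Gamma>. pmf \<pi> x * f x / live q)"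
    by (intro sum.cong) (auto simp: letter_prob_def)
  finally show ?thesis by (simp add: sum_divide_distrib)
qed

lemma sum_letter_prob: "(\<Sum>x\<in>UNIV. letter_prob q x) = (if live q = 0 then 0 else 1)"
  using sum_letter_prob_mult[of q "\<lambda>_. 1"] by (simp add: live_def)

text \<open>A letter never read before is independent of the past, and all letters are then admissible;
  otherwise the memory of the state makes exactly one letter admissible.\<close>

lemma letter_prob_fresh:
  assumes "access s i \<notin> access s ` {..<i}"
  shows "letter_prob (st s i) x = pmf \<pi> x"
proof -
  have "trans_fun \<Gamma> (st s i) y \<noteq> sink \<Gamma>" for y
    using trans_st_eq_sink_iff[OF st_not_sink] assms by simp
  then show ?thesis
    by (simp add: letter_prob_def live_def sum_pmf_eq_1)
qed

lemma letter_prob_known: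
  assumes "access s i \<in> access s ` {..<i}"
  shows "letter_prob (st s i) x =
    (if x = letter s i \<and> pmf \<pi> (letter s i) \<noteq> 0 then 1 else 0)"
proof -
  have "trans_fun \<Gamma> (st s i) y \<noteq> sink \<Gamma> \<longleftrightarrow> y = letter s i" for y
    using trans_st_eq_sink_iff[OF st_not_sink] assms by simp
  then show ?thesis
    by (simp add: letter_prob_def live_def)
qed

text \<open>Given the history, the next accessed position is fixed. If it is fresh, its letter is an
  independent coordinate of the text; if not, its letter is already determined. This is the source
  of the Markov property.\<close>

lemma prob_next_letter:
  assumes L: "horizon i < L"
  shows "measure_pmf.prob (texts L) {s. hist s i = hist s0 i \<and> letter s i = x} =
    measure_pmf.prob (texts L) {s. hist s i = hist s0 i} * letter_prob (st s0 i) x"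
proof -
  let ?D = "access s0 ` {..<i}" and ?a = "access s0 i"
  have acc: "access s0 j < L" if "j \<le> i" for j
    using access_le_horizon[OF that, of s0] L by simp
  have D: "?D \<subseteq> {..<L}" using acc by auto
  have *: "{s. hist s i = hist s0 i \<and> letter s i = x} =
      {s. (\<forall>u\<in>?D. s u = s0 u) \<and> s ?a = x}"
  proof (rule Collect_cong, rule conj_cong)
    fix s
    show "hist s i = hist s0 i \<longleftrightarrow> (\<forall>u\<in>?D. s u = s0 u)" by (rule hist_eq_iff)
    assume "\<forall>u\<in>?D. s u = s0 u"
    then have "hist s i = hist s0 i" by (simp only: hist_eq_iff)
    from hist_determines(3)[OF this order_refl] show "letter s i = x \<longleftrightarrow> s ?a = x"
      by (simp add: letter_def)
  qed
  have prob: "measure_pmf.prob (texts L) {s. hist s i = hist s0 i} = (\<Prod>u\<in>?D. pmf \<pi> (s0 u))"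
    unfolding hist_eq_iff by (rule prob_cylinder[OF D])
  show ?thesis
  proof (cases "?a \<in> ?D")
    case True
    show ?thesis
    proof (cases "x = letter s0 i")
      case x: True
      then have "{s. hist s i = hist s0 i \<and> letter s i = x} = {s. hist s i = hist s0 i}"
        unfolding * unfolding hist_eq_iff using True by (auto simp: letter_def)
      \<comment> \<open>Here \<open>letter_prob\<close> has its default value 0, which is harmless
        because the history itself has probability 0.\<close>
      moreover have "(\<Prod>u\<in>?D. pmf \<pi> (s0 u)) = 0" if "pmf \<pi> (letter s0 i) = 0"
        using True that by (intro prod_zero) (auto simp: letter_def)
      ultimately show ?thesis
        using x by (auto simp: prob letter_prob_known[OF True])
    next
      case False
      then have "{s. hist s i = hist s0 i \<and> letter s i = x} = {}"
        unfolding * using True by (auto simp: letter_def)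
      then have "measure_pmf.prob (texts L) {s. hist s i = hist s0 i \<and> letter s i = x} = 0"
        by (simp only: measure_empty)
      then show ?thesis
        using False by (simp only: letter_prob_known[OF True]) simp
    qed
  next
    case False
    have upd: "(s0(?a := x)) (access s0 j) = s0 (access s0 j)" if "j < i" for j
      using False that by (metis fun_upd_other imageI lessThan_iff)
    have "{s. hist s i = hist s0 i \<and> letter s i = x} =
        {s. \<forall>u\<in>insert ?a ?D. s u = (s0(?a := x)) u}"
      unfolding * by (auto simp: upd fun_upd_same simp del: fun_upd_apply)
    also have "measure_pmf.prob (texts L) \<dots> = (\<Prod>u\<in>insert ?a ?D. pmf \<pi> ((s0(?a := x)) u))"
      using D acc[of i] by (intro prob_cylinder) auto
    also have "\<dots> = pmf \<pi> x * (\<Prod>u\<in>?D. pmf \<pi> ((s0(?a := x)) u))"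
      using False by (subst prod.insert) auto
    also have "(\<Prod>u\<in>?D. pmf \<pi> ((s0(?a := x)) u)) = (\<Prod>u\<in>?D. pmf \<pi> (s0 u))"
      by (intro prod.cong) (auto simp: upd simp del: fun_upd_apply)
    finally show ?thesis by (simp add: prob letter_prob_fresh[OF False])
  qed
qed

text \<open>Conditioning on the history, carried out as a finite sum over the possible
  histories.\<close>

lemma E_next_letter:
  assumes "horizon i < L" "adapted i \<Phi>"
  shows "E L (\<lambda>s. \<Phi> s * \<psi> (st s i) (letter s i)) =
    E L (\<lambda>s. \<Phi> s * (\<Sum>x\<in>UNIV. letter_prob (st s i) x * \<psi> (st s i) x))"
proof -
  \<comment> \<open>Adapted quantities are functions of texts; evaluating them at a representative
    makes them functions of the history.\<close>
  define rep where "rep h = (SOME s. hist s i = h)" for h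
  have rep: "hist (rep (hist s i)) i = hist s i" for s
    unfolding rep_def by (rule someI[where P = "\<lambda>s'. hist s' i = hist s i"]) simp
  define G where "G h x = \<Phi> (rep h) * \<psi> (st (rep h) i) x" for h x
  have G: "G (hist s i) x = \<Phi> s * \<psi> (st s i) x" for s x
    using adaptedD[OF assms(2) rep] hist_determines(1)[OF rep] by (simp add: G_def)
  have st_rep: "st (rep (hist s i)) i = st s i" for s
    using hist_determines(1)[OF rep] by simp
  let ?H = "{h :: 'a list. set h \<subseteq> UNIV \<and> length h = i}"
  let ?p = "measure_pmf.prob (texts L)"
  have fin: "finite ?H" by (intro finite_lists_length_eq) simp
  have eq: "?p {s. hist s i = h \<and> letter s i = x} =
      ?p {s. hist s i = h} * letter_prob (st (rep h) i) x" for h x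
  proof (cases "\<exists>s. hist s i = h")
    case True
    then have "hist (rep h) i = h" using rep by auto
    then show ?thesis using prob_next_letter[OF assms(1), of "rep h" x] by simp
  qed simp
  have "E L (\<lambda>s. \<Phi> s * \<psi> (st s i) (letter s i)) =
      E L (\<lambda>s. case (hist s i, letter s i) of (h, x) \<Rightarrow> G h x)"
    by (simp add: G)
  also have "\<dots> = (\<Sum>(h, x)\<in>?H \<times> UNIV. G h x * ?p {s. hist s i = h \<and> letter s i = x})"
    using fin by (subst E_by_values[where A = "?H \<times> UNIV"]) (auto intro!: sum.cong)
  also have "\<dots> = (\<Sum>h\<in>?H. (\<Sum>x\<in>UNIV. letter_prob (st (rep h) i) x * G h x) * ?p {s. hist s i = h})"
    by (simp add: eq sum.cartesian_product[symmetric] sum_distrib_left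
        sum_distrib_right mult_ac)
  also have "\<dots> = E L (\<lambda>s. \<Sum>x\<in>UNIV. letter_prob (st (rep (hist s i)) i) x * G (hist s i) x)"
    using fin by (subst E_by_values[where A = ?H and Y = "\<lambda>s. hist s i",
          of L "\<lambda>h. \<Sum>x\<in>UNIV. letter_prob (st (rep h) i) x * G h x"]) auto
  finally show ?thesis
    by (simp add: G st_rep sum_distrib_left mult_ac)
qed

end

section \<open>Passage times and martingales\<close>

lemma finite_initial_segment:
  fixes A :: "nat set"
  assumes "finite A" "\<And>i j. j \<in> A \<Longrightarrow> i \<le> j \<Longrightarrow> i \<in> A"
  shows "A = {..<card A}"
proof -
  define m where "m = (LEAST m. m \<notin> A)"
  have "\<exists>m. m \<notin> A" using assms(1) ex_new_if_finite infinite_UNIV_nat by blast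
  then have "m \<notin> A" unfolding m_def by (rule LeastI_ex)
  moreover have "i \<in> A" if "i < m" for i
    using not_less_Least that unfolding m_def by blast
  ultimately have "A = {..<m}"
    using assms(2) by (metis lessThan_iff not_le subsetI subset_antisym)
  then show ?thesis by simp
qed

lemma cesaro_null:
  fixes x :: "nat \<Rightarrow> real"
  assumes "x \<longlonglongrightarrow> 0"
  shows "(\<lambda>n. (\<Sum>i<n. x i) / real n) \<longlonglongrightarrow> 0"
proof (rule tendstoI)
  fix e :: real
  assume e: "e > 0"
  then obtain k where k: "\<And>i. i \<ge> k \<Longrightarrow> \<bar>x i\<bar> < e / 2"
    using LIMSEQ_D[OF assms, of "e / 2"] by auto
  define A where "A = (\<Sum>i<k. \<bar>x i\<bar>)"
  have "(\<lambda>n. A / real n) \<longlonglongrightarrow> 0" by (rule lim_const_over_n)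
  from order_tendstoD(2)[OF this, of "e / 2"] e
  have "\<forall>\<^sub>F n in sequentially. A / real n < e / 2" by simp
  moreover have "\<forall>\<^sub>F n in sequentially. n > k" by (rule eventually_gt_at_top)
  ultimately show "\<forall>\<^sub>F n in sequentially. dist ((\<Sum>i<n. x i) / real n) 0 < e"
  proof eventually_elim
    case (elim n)
    have "\<bar>\<Sum>i<n. x i\<bar> \<le> (\<Sum>i<n. \<bar>x i\<bar>)" by (rule sum_abs)
    also have "\<dots> = A + (\<Sum>i\<in>{k..<n}. \<bar>x i\<bar>)"
      using elim by (simp add: A_def lessThan_atLeast0 sum.atLeastLessThan_concat)
    also have "(\<Sum>i\<in>{k..<n}. \<bar>x i\<bar>) \<le> (\<Sum>i\<in>{k..<n}. e / 2)"
      using k by (intro sum_mono less_imp_le) simp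
    also have "\<dots> \<le> real n * (e / 2)"
      using e by (simp add: mult_right_mono)
    finally have "\<bar>\<Sum>i<n. x i\<bar> / real n \<le> (A + real n * (e / 2)) / real n"
      by (intro divide_right_mono) simp_all
    also have "\<dots> = A / real n + e / 2"
      using elim by (simp add: add_divide_distrib)
    finally have "\<bar>\<Sum>i<n. x i\<bar> / real n < e" using elim by linarith
    then show ?case by (simp add: dist_real_def)
  qed
qed

context valid_standard_machine
begin

text \<open>As positions never decrease, this number of steps is also the first time at which the
  position is at least \<open>c\<close>. Counting makes the link with \<open>accesses\<close>
  immediate.\<close>

definition "passage c s = card {i. pos s i < c}"

lemma less_passage_iff: "i < passage c s \<longleftrightarrow> pos s i < c"
proof -
  have "{i. pos s i < c} \<subseteq> {..<c * card (states \<Gamma>)}"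
  proof
    fix i
    assume "i \<in> {i. pos s i < c}"
    then have "pos s i < pos s (c * card (states \<Gamma>))"
      using pos_add_mult[of s 0 c] by simp
    then show "i \<in> {..<c * card (states \<Gamma>)}"
      using pos_mono[of "c * card (states \<Gamma>)" i s] by (metis lessThan_iff linorder_not_le)
  qed
  then have "finite {i. pos s i < c}" using finite_subset by blast
  then have "{i. pos s i < c} = {..<passage c s}"
    unfolding passage_def by (rule finite_initial_segment) (metis mem_Collect_eq pos_mono le_less_trans)
  then show ?thesis by blast
qed

lemma le_pos_passage: "c \<le> pos s (passage c s)"
  using less_passage_iff[of "passage c s" c s] by simp

lemma passage_leI: "c \<le> pos s i \<Longrightarrow> passage c s \<le> i"
  using less_passage_iff[of i c s] by simp

text \<open>The step before the passage starts below \<open>c\<close>, so the overshoot is at most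
  one shift.\<close>

lemma pos_passage_le: "pos s (passage c s) \<le> c + max_shift"
proof (cases "passage c s")
  case (Suc k)
  then have "pos s k < c" using less_passage_iff[of k c s] by simp
  then show ?thesis
    using Suc shift_le[OF st_in[of s k], of "letter s k"] by simp
qed simp

lemma passage_add_le: "passage (c + b) s \<le> passage c s + b * card (states \<Gamma>)"
  using pos_add_mult[of s "passage c s" b] le_pos_passage[of c s]
  by (intro passage_leI) simp

lemma passage_le: "passage c s \<le> c * card (states \<Gamma>)"
  using pos_add_mult[of s 0 c] by (intro passage_leI) simp

lemma passage_mono: "c \<le> c' \<Longrightarrow> passage c s \<le> passage c' s"
  using le_pos_passage[of c' s] by (intro passage_leI) simp

lemma le_mult_passage: "c \<le> max_shift * passage c s"
  using le_pos_passage[of c s] pos_le[of s "passage c s"] by simp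

text \<open>Before the passage of \<open>c\<close> every access is below
  \<open>c + machine_order \<Gamma>\<close>, so letters further on have no influence.\<close>

lemma passage_cong:
  assumes "\<And>u. u < c + machine_order \<Gamma> \<Longrightarrow> s' u = s u"
  shows "passage c s' = passage c s"
proof -
  have "pos s' i = pos s i" if "i \<le> passage c s" for i
  proof -
    have "access s j < c + machine_order \<Gamma>" if "j < passage c s" for j
      using that access_le[of s j] less_passage_iff[of j c s] by simp
    with assms that show ?thesis by (intro history_cong(2)[of i]) simp_all
  qed
  then have "pos s' i < c \<longleftrightarrow> i < passage c s" for i
    using le_pos_passage[of c s] less_passage_iff[of i c s] pos_mono[of "passage c s" i s']
    by (cases "i \<le> passage c s") auto
  then show ?thesis by (simp add: passage_def[of c s'])
qed

end

section \<open>The state chain and its martingales\<close>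

context bernoulli_machine
begin

text \<open>Letters are grouped by their target state; those leading to the sink have weight 0. This
  identifies one step of the machine with one step of the chain.\<close>

lemma sum_letter_prob_trans:
  assumes "q \<in> states \<Gamma>"
  shows "(\<Sum>x\<in>UNIV. letter_prob q x * f (trans_fun \<Gamma> q x)) =
    kernel_op (states \<Gamma> - {sink \<Gamma>}) (chain_trans \<Gamma> \<pi>) f q"
proof -
  let ?S = "states \<Gamma> - {sink \<Gamma>}" and ?X = "{x. trans_fun \<Gamma> q x \<noteq> sink \<Gamma>}"
  have "(\<Sum>x\<in>?X. pmf \<pi> x * f (trans_fun \<Gamma> q x)) =
      (\<Sum>q'\<in>?S. \<Sum>x\<in>{x \<in> ?X. trans_fun \<Gamma> q x = q'}. pmf \<pi> x * f (trans_fun \<Gamma> q x))"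
    by (rule sum.group[symmetric]) (use assms trans_in finite_states in auto)
  also have "\<dots> = (\<Sum>q'\<in>?S. (\<Sum>x | trans_fun \<Gamma> q x = q'. pmf \<pi> x) * f q')"
    unfolding sum_distrib_right by (intro sum.cong) auto
  finally show ?thesis
    by (simp add: sum_letter_prob_mult kernel_op_def chain_trans_def live_def
        sum_divide_distrib[symmetric])
qed

lemma expected_shift_eq:
  "expected_shift \<Gamma> \<pi> q = (\<Sum>x\<in>UNIV. letter_prob q x * real (shift_fun \<Gamma> q x))"
  unfolding expected_shift_def sum_letter_prob_mult live_def by (simp add: mult.commute)

sublocale chain: substochastic_kernel "states \<Gamma> - {sink \<Gamma>}" "chain_trans \<Gamma> \<pi>"
proof
  fix q
  assume q: "q \<in> states \<Gamma> - {sink \<Gamma>}"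
  have "(\<Sum>q'\<in>states \<Gamma> - {sink \<Gamma>}. chain_trans \<Gamma> \<pi> q q') = (\<Sum>x\<in>UNIV. letter_prob q x)"
    using sum_letter_prob_trans[of q "\<lambda>_. 1"] q by (simp add: kernel_op_def)
  then show "(\<Sum>q'\<in>states \<Gamma> - {sink \<Gamma>}. chain_trans \<Gamma> \<pi> q q') \<le> 1"
    by (simp add: sum_letter_prob)
qed (auto simp: finite_states chain_trans_def intro!: divide_nonneg_nonneg sum_nonneg)

abbreviation "chain_pow \<equiv> kernel_pow (states \<Gamma> - {sink \<Gamma>}) (chain_trans \<Gamma> \<pi>)"

lemma st_in_chain: "st s i \<in> states \<Gamma> - {sink \<Gamma>}"
  by (simp add: st_in st_not_sink)

lemma adapted_st: "j \<le> i \<Longrightarrow> adapted i (\<lambda>s. f (st s j))"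
  by (rule adaptedI) (metis hist_determines(1))

lemma E_trans:
  assumes "horizon i < L" "adapted i \<Phi>"
  shows "E L (\<lambda>s. \<Phi> s * f (st s (Suc i))) = E L (\<lambda>s. \<Phi> s * chain.P f (st s i))"
  using E_next_letter[OF assms, of "\<lambda>q x. f (trans_fun \<Gamma> q x)"]
  by (simp add: sum_letter_prob_trans[OF st_in, where f = f])

lemma E_st:
  assumes "horizon i < L"
  shows "E L (\<lambda>s. f (st s i)) = chain_pow i f (initial \<Gamma>)"
  using assms
proof (induction i arbitrary: f)
  case (Suc i)
  have "horizon i < L" using Suc.prems horizon_mono[of i "Suc i"] by simp
  then have "E L (\<lambda>s. f (st s (Suc i))) = E L (\<lambda>s. chain.P f (st s i))"
    using E_trans[of i L "\<lambda>_. 1" f] by (simp add: adapted_def)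
  then show ?case
    using Suc.IH[OF \<open>horizon i < L\<close>, of "chain.P f"]
    by (simp del: funpow.simps st_Suc add: funpow_Suc_right)
qed simp

text \<open>For harmonic \<open>g\<close> the values along the run form a martingale, so the later
  factor can be moved back to step \<open>i\<close>, one step at a time.\<close>

lemma E_harmonic_prod:
  assumes "\<And>q. q \<in> states \<Gamma> - {sink \<Gamma>} \<Longrightarrow> chain.P g q = g q"
    and "i \<le> j" "horizon j < L"
  shows "E L (\<lambda>s. g (st s i) * g (st s j)) = E L (\<lambda>s. (g (st s i))\<^sup>2)"
  using assms(2,3)
proof (induction j rule: dec_induct)
  case base
  then show ?case by (simp add: power2_eq_square)
next
  case (step j)
  have "horizon j < L" using step.prems horizon_mono[of j "Suc j"] by simp
  with step E_trans[of j L "\<lambda>s. g (st s i)" g] show ?case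
    by (simp del: st_Suc add: adapted_st assms(1)[OF st_in_chain])
qed

text \<open>Pythagoras for martingale increments. Since the second moments converge, the martingale
  is Cauchy in L2.\<close>

lemma E_harmonic_diff:
  assumes "\<And>q. q \<in> states \<Gamma> - {sink \<Gamma>} \<Longrightarrow> chain.P g q = g q"
    and "i \<le> j" "horizon j < L"
  shows "E L (\<lambda>s. (g (st s i) - g (st s j))\<^sup>2) =
    chain_pow j (\<lambda>q. (g q)\<^sup>2) (initial \<Gamma>) - chain_pow i (\<lambda>q. (g q)\<^sup>2) (initial \<Gamma>)"
proof -
  have i: "horizon i < L" using assms(2,3) horizon_mono[of i j] by simp
  have "E L (\<lambda>s. (g (st s i) - g (st s j))\<^sup>2) =
      E L (\<lambda>s. (g (st s i))\<^sup>2) + E L (\<lambda>s. (g (st s j))\<^sup>2) - 2 * E L (\<lambda>s. g (st s i) * g (st s j))"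
    by (simp add: power2_diff mult.assoc)
  then show ?thesis
    using E_harmonic_prod[OF assms] E_st[OF i, of "\<lambda>q. (g q)\<^sup>2"]
      E_st[OF assms(3), of "\<lambda>q. (g q)\<^sup>2"] by simp
qed

text \<open>The increments are orthogonal: the past sum times the weight is adapted and
  \<open>d\<close> is centered, so the cross term vanishes. The weights \<open>c\<close> serve to
  stop the sum at a passage time.\<close>

lemma E_martingale_sum_sq:
  assumes centered: "\<And>q. q \<in> states \<Gamma> \<Longrightarrow> (\<Sum>x\<in>UNIV. letter_prob q x * d q x) = 0"
    and bounded: "\<And>q x. q \<in> states \<Gamma> \<Longrightarrow> \<bar>d q x\<bar> \<le> D"
    and c: "\<And>i. adapted i (c i)" "\<And>i s. \<bar>c i s\<bar> \<le> 1"
    and L: "horizon m < L"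
  shows "E L (\<lambda>s. (\<Sum>i<m. c i s * d (st s i) (letter s i))\<^sup>2) \<le> real m * D\<^sup>2"
  using L
proof (induction m)
  case (Suc m)
  define A where "A s = (\<Sum>i<m. c i s * d (st s i) (letter s i))" for s
  have L: "horizon m < L" using Suc.prems horizon_mono[of m "Suc m"] by simp
  have "adapted m (\<lambda>s. A s * c m s)"
  proof (rule adaptedI)
    fix s s'
    assume h: "hist s m = hist s' m"
    have "c i s = c i s'" if "i \<le> m" for i
      using h that by (intro adaptedD[OF c(1)]) (simp add: hist_eq_iff_letter)
    then show "A s * c m s = A s' * c m s'"
      by (simp add: A_def hist_determines(1,4)[OF h])
  qed
  then have cross: "E L (\<lambda>s. A s * c m s * d (st s m) (letter s m)) = 0"
    using L by (subst E_next_letter) (simp_all add: centered[OF st_in])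
  have "(c m s * d (st s m) (letter s m))\<^sup>2 \<le> D\<^sup>2" for s
  proof -
    have "\<bar>c m s * d (st s m) (letter s m)\<bar> \<le> 1 * D"
      unfolding abs_mult by (intro mult_mono c bounded st_in) simp_all
    then show ?thesis by (simp add: abs_le_square_iff[symmetric])
  qed
  then have "E L (\<lambda>s. (c m s * d (st s m) (letter s m))\<^sup>2) \<le> E L (\<lambda>_. D\<^sup>2)"
    by (rule E_mono)
  moreover have "E L (\<lambda>s. (A s + c m s * d (st s m) (letter s m))\<^sup>2) = E L (\<lambda>s. (A s)\<^sup>2)
      + E L (\<lambda>s. (c m s * d (st s m) (letter s m))\<^sup>2)
      + 2 * E L (\<lambda>s. A s * c m s * d (st s m) (letter s m))"
    by (simp add: power2_sum mult.assoc)
  ultimately show ?case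
    using Suc.IH[OF L] cross by (simp add: A_def algebra_simps)
qed simp

end

section \<open>The speed on random texts\<close>

context bernoulli_machine
begin

lemma accesses_eq_passage:
  "length w \<le> length t \<Longrightarrow>
    accesses a0 w \<Gamma> t = passage (length t + 1 - length w) (text_symbol a0 t)"
  by (auto simp: accesses_def passage_def loop_test_def config_eq_run pos_def
      intro!: arg_cong[where f = card])

lemma bij_betw_text_symbol:
  "bij_betw (text_symbol a0) {t. length t = n} (PiE_dflt {..<n} a0 (\<lambda>_. UNIV))"
proof (rule bij_betwI[where g = "\<lambda>s. map s [0..<n]"])
  show "map (text_symbol a0 t) [0..<n] = t" if "t \<in> {t. length t = n}" for t
    using that by (intro nth_equalityI) (auto simp: text_symbol_def)
  show "text_symbol a0 (map s [0..<n]) = s" if "s \<in> PiE_dflt {..<n} a0 (\<lambda>_. UNIV)" for s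
    using that by (auto simp: text_symbol_def PiE_dflt_def)
qed (auto simp: text_symbol_def PiE_dflt_def)

lemma sum_text_prob:
  "(\<Sum>t | length t = n. F (text_symbol a0 t) * text_prob \<pi> t) = E n F"
proof -
  have "E n F = (\<Sum>s\<in>PiE_dflt {..<n} a0 (\<lambda>_. UNIV). F s * pmf (texts n) s)"
  proof (rule integral_measure_pmf_real)
    show "finite (PiE_dflt {..<n} a0 (\<lambda>_. UNIV :: 'a set))" by auto
    show "s \<in> PiE_dflt {..<n} a0 (\<lambda>_. UNIV)" if "s \<in> set_pmf (texts n)" for s
      using that set_Pi_pmf_subset[of "{..<n}" a0 "\<lambda>_. \<pi>"]
      by (auto simp: texts_def PiE_dflt_def)
  qed
  also have "\<dots> = (\<Sum>t | length t = n. F (text_symbol a0 t) * pmf (texts n) (text_symbol a0 t))"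
    by (rule sum.reindex_bij_betw[OF bij_betw_text_symbol, symmetric])
  also have "\<dots> = (\<Sum>t | length t = n. F (text_symbol a0 t) * text_prob \<pi> t)"
  proof (intro sum.cong refl arg_cong2[where f = times])
    fix t :: "'a list"
    assume "t \<in> {t. length t = n}"
    then have n: "length t = n" by simp
    have "pmf (texts n) (text_symbol a0 t) = (\<Prod>u<n. pmf \<pi> (text_symbol a0 t u))"
      unfolding texts_def by (rule pmf_Pi') (simp_all add: text_symbol_def n)
    also have "\<dots> = text_prob \<pi> t"
      unfolding text_prob_def n by (intro prod.cong) (simp_all add: text_symbol_def n)
    finally show "pmf (texts n) (text_symbol a0 t) = text_prob \<pi> t" .
  qed
  finally show ?thesis by simp
qed

text \<open>Places a random text of length \<open>n\<close> inside a longer one, on which the run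
  can be followed past \<open>n\<close> with letters that are still random.\<close>

definition cut_text :: "nat \<Rightarrow> (nat \<Rightarrow> 'a) \<Rightarrow> nat \<Rightarrow> 'a" where
  "cut_text n s u = (if u < n then s u else a0)"

lemma expected_speed_eq:
  assumes "length w \<le> n" "n \<le> L"
  shows "expected_speed a0 w \<Gamma> \<pi> n =
    E L (\<lambda>s. real n / real (passage (n + 1 - length w) (cut_text n s)))"
proof -
  have "expected_speed a0 w \<Gamma> \<pi> n =
      E n (\<lambda>s. real n / real (passage (n + 1 - length w) s))"
    unfolding expected_speed_def sum_text_prob[symmetric]
    using assms(1) by (intro sum.cong) (auto simp: accesses_eq_passage)
  also have "texts n = map_pmf (cut_text n) (texts L)"
    using Pi_pmf_subset[of "{..<L}" "{..<n}" a0 "\<lambda>_. \<pi>"] assms(2)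
    by (simp add: texts_def cut_text_def[abs_def])
  finally show ?thesis by simp
qed

lemma passage_pos: "0 < c \<Longrightarrow> 0 < passage c s"
  using le_mult_passage[of c s] by (cases "passage c s") auto

lemma inverse_passage_le:
  assumes "0 < c"
  shows "1 / real (passage c s) \<le> real max_shift / real c"
proof -
  have "real c \<le> real max_shift * real (passage c s)"
    using le_mult_passage[of c s] by (simp only: of_nat_mult[symmetric] of_nat_le_iff)
  then show ?thesis
    using passage_pos[OF assms, of s] assms by (simp add: field_simps)
qed

text \<open>Two replacements: \<open>c + k\<close> by the position at the passage, at bounded cost
  by the overshoot bound, and \<open>a\<close> by the passage time, at most \<open>b\<close>
  smaller. Each costs O(1/passage), and the passage time is at least
  \<open>c / max_shift\<close>.\<close>

lemma speed_position_error:
  assumes c: "0 < c" and a: "passage c s \<le> a" "a \<le> passage c s + b"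
  shows "\<bar>real (c + k) / real a - real (pos s (passage c s)) / real (passage c s)\<bar>
    \<le> (real k + real max_shift + real max_shift * real b) * (real max_shift / real c)"
proof -
  define t where "t = passage c s"
  define p where "p = pos s t"
  have t: "0 < t" using passage_pos[OF c] by (simp add: t_def)
  have p: "c \<le> p" "p \<le> c + max_shift" "p \<le> max_shift * t"
    using le_pos_passage[of c s] pos_passage_le[of s c] pos_le[of s t] by (simp_all add: p_def t_def)
  have a': "t \<le> a" "a \<le> t + b" using a by (simp_all add: t_def)
  have "\<bar>(real (c + k) - real p) / real a\<bar> \<le> (real k + real max_shift) / real t"
  proof -
    have "\<bar>real (c + k) - real p\<bar> \<le> real k + real max_shift" using p by linarith
    then show ?thesis
      unfolding abs_divide using t a' by (intro frac_le) simp_all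
  qed
  moreover have "\<bar>real p / real a - real p / real t\<bar> \<le> (real max_shift * real b) / real t"
  proof -
    have "\<bar>real p / real a - real p / real t\<bar> = real p * (real a - real t) / (real a * real t)"
    proof -
      have "real p / real t - real p / real a = real p * (real a - real t) / (real a * real t)"
        using t a' by (simp add: field_simps)
      moreover have "0 \<le> real p * (real a - real t) / (real a * real t)" using a' by simp
      ultimately show ?thesis by (subst abs_minus_commute) (simp only: abs_of_nonneg)
    qed
    also have "\<dots> \<le> (real max_shift * real t) * real b / (real t * real t)"
    proof (intro frac_le mult_mono mult_right_mono)
      show "real p \<le> real max_shift * real t"
        using p(3) by (simp only: of_nat_mult[symmetric] of_nat_le_iff)
    qed (use t a' in auto)
    also have "\<dots> = (real max_shift * real b) / real t"
      using t by simp
    finally show ?thesis .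
  qed
  moreover have "real (c + k) / real a - real p / real t =
      (real (c + k) - real p) / real a + (real p / real a - real p / real t)"
    by (simp add: diff_divide_distrib)
  ultimately have "\<bar>real (c + k) / real a - real p / real t\<bar> \<le>
      (real k + real max_shift) / real t + (real max_shift * real b) / real t"
    by linarith
  also have "\<dots> = (real k + real max_shift + real max_shift * real b) * (1 / real t)"
    by (simp add: add_divide_distrib)
  also have "\<dots> \<le> (real k + real max_shift + real max_shift * real b) * (real max_shift / real c)"
    using inverse_passage_le[OF c, of s] by (intro mult_left_mono) (simp_all add: t_def)
  finally show ?thesis by (simp add: t_def p_def)
qed

text \<open>The increment of position plus \<open>h\<close> of the state, minus its conditional
  mean: a martingale difference along the run.\<close>

definition centered_shift :: "('q \<Rightarrow> real) \<Rightarrow> 'q \<Rightarrow> 'a \<Rightarrow> real" where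
  "centered_shift h q x = real (shift_fun \<Gamma> q x) - expected_shift \<Gamma> \<pi> q
     + h (trans_fun \<Gamma> q x) - chain.P h q"

lemma sum_centered_shift:
  assumes "q \<in> states \<Gamma>"
  shows "(\<Sum>x\<in>UNIV. letter_prob q x * centered_shift h q x) = 0"
proof -
  define e where "e = expected_shift \<Gamma> \<pi> q"
  define m where "m = chain.P h q"
  have "(\<Sum>x\<in>UNIV. letter_prob q x * centered_shift h q x) =
      (\<Sum>x\<in>UNIV. letter_prob q x * real (shift_fun \<Gamma> q x))
      + (\<Sum>x\<in>UNIV. letter_prob q x * h (trans_fun \<Gamma> q x)) - (\<Sum>x\<in>UNIV. letter_prob q x) * (e + m)"
    unfolding centered_shift_def e_def[symmetric] m_def[symmetric]
    by (simp add: algebra_simps sum.distrib sum_subtractf sum_distrib_right sum_distrib_left)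
  also have "\<dots> = e + m - (\<Sum>x\<in>UNIV. letter_prob q x) * (e + m)"
    by (simp add: e_def m_def expected_shift_eq sum_letter_prob_trans[OF assms, where f = h])
  finally have "(\<Sum>x\<in>UNIV. letter_prob q x * centered_shift h q x) =
      e + m - (\<Sum>x\<in>UNIV. letter_prob q x) * (e + m)" .
  \<comment> \<open>In this case the letter weights sum to 0 rather than 1, but both means vanish as
    well.\<close>
  moreover have "e + m = 0" if "live q = 0"
  proof -
    have "letter_prob q x = 0" for x using that by (simp add: letter_prob_def)
    then show ?thesis
      by (simp add: e_def m_def expected_shift_eq
          sum_letter_prob_trans[OF assms, where f = h, symmetric])
  qed
  ultimately show ?thesis by (simp add: sum_letter_prob)
qed

text \<open>A martingale, two boundary terms, and a drift from which \<open>h - P h\<close> has been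
  removed. When \<open>h\<close> solves the Poisson equation approximately, the drift is close to
  \<open>g\<close> of the state.\<close>

lemma pos_decomposition:
  "real (pos s k) = (\<Sum>i<k. centered_shift h (st s i) (letter s i)) + h (initial \<Gamma>) - h (st s k)
     + (\<Sum>i<k. expected_shift \<Gamma> \<pi> (st s i) - (h (st s i) - chain.P h (st s i)))"
  by (induction k) (auto simp: centered_shift_def algebra_simps)

text \<open>The random passage time is traded for the deterministic \<open>N\<close>: the stopped
  martingale becomes a sum up to \<open>N\<close> with indicator weights, and each
  \<open>g (st s i)\<close> is compared with the single value \<open>g (st s N)\<close>.\<close>

lemma mean_position_error:
  assumes c: "0 < c" and N: "passage c s \<le> N"
    and h: "\<And>q. q \<in> states \<Gamma> - {sink \<Gamma>} \<Longrightarrow> \<bar>h q\<bar> \<le> B"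
    and g: "\<And>q. q \<in> states \<Gamma> - {sink \<Gamma>} \<Longrightarrow>
      \<bar>expected_shift \<Gamma> \<pi> q - g q - (h q - chain.P h q)\<bar> \<le> \<epsilon>"
  shows "\<bar>real (pos s (passage c s)) / real (passage c s) - g (st s N)\<bar> \<le>
    (\<bar>\<Sum>i<N. of_bool (pos s i < c) * centered_shift h (st s i) (letter s i)\<bar> + 2 * B
       + (\<Sum>i<N. \<bar>g (st s i) - g (st s N)\<bar>)) * (real max_shift / real c) + \<epsilon>"
proof -
  define t where "t = passage c s"
  have t: "0 < t" using passage_pos[OF c] by (simp add: t_def)
  define X where "X = (\<Sum>i<N. of_bool (pos s i < c) * centered_shift h (st s i) (letter s i))"
  define Y where "Y = (\<Sum>i<N. \<bar>g (st s i) - g (st s N)\<bar>)"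
  have X: "(\<Sum>i<t. centered_shift h (st s i) (letter s i)) = X"
    unfolding X_def less_passage_iff[symmetric] t_def
    by (rule sum.mono_neutral_cong_left) (use N in auto)
  define r where "r i = expected_shift \<Gamma> \<pi> (st s i) - g (st s i)
      - (h (st s i) - chain.P h (st s i))" for i
  have "real (pos s t) - real t * g (st s N) = X + h (initial \<Gamma>) - h (st s t)
      + (\<Sum>i<t. g (st s i) - g (st s N)) + (\<Sum>i<t. r i)"
    unfolding pos_decomposition[of s t h] X by (simp add: r_def sum.distrib sum_subtractf)
  moreover have "\<bar>h (initial \<Gamma>)\<bar> \<le> B" "\<bar>h (st s t)\<bar> \<le> B"
    using h[OF st_in_chain] h[OF st_in_chain[of s 0]] by simp_all
  moreover have "\<bar>\<Sum>i<t. g (st s i) - g (st s N)\<bar> \<le> Y"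
  proof -
    have "\<bar>\<Sum>i<t. g (st s i) - g (st s N)\<bar> \<le> (\<Sum>i<t. \<bar>g (st s i) - g (st s N)\<bar>)"
      by (rule sum_abs)
    also have "\<dots> \<le> Y"
      unfolding Y_def using N by (intro sum_mono2) (auto simp: t_def)
    finally show ?thesis .
  qed
  moreover have "\<bar>\<Sum>i<t. r i\<bar> \<le> real t * \<epsilon>"
  proof -
    have "\<bar>\<Sum>i<t. r i\<bar> \<le> (\<Sum>i<t. \<bar>r i\<bar>)" by (rule sum_abs)
    also have "\<dots> \<le> (\<Sum>i<t. \<epsilon>)"
      unfolding r_def by (intro sum_mono g st_in_chain)
    finally show ?thesis by simp
  qed
  ultimately have "\<bar>real (pos s t) - real t * g (st s N)\<bar> \<le> \<bar>X\<bar> + 2 * B + Y + real t * \<epsilon>"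
    by linarith
  then have "\<bar>real (pos s t) - real t * g (st s N)\<bar> / real t \<le>
      (\<bar>X\<bar> + 2 * B + Y + real t * \<epsilon>) / real t"
    by (rule divide_right_mono) simp
  moreover have "\<bar>real (pos s t) - real t * g (st s N)\<bar> / real t =
      \<bar>real (pos s t) / real t - g (st s N)\<bar>"
  proof -
    have "real (pos s t) / real t - g (st s N) = (real (pos s t) - real t * g (st s N)) / real t"
      using t by (simp add: diff_divide_distrib)
    then show ?thesis by (simp only: abs_divide abs_of_nat)
  qed
  moreover have "(\<bar>X\<bar> + 2 * B + Y + real t * \<epsilon>) / real t =
      (\<bar>X\<bar> + 2 * B + Y) * (1 / real t) + \<epsilon>"
    using t by (simp add: add_divide_distrib)
  moreover have "(\<bar>X\<bar> + 2 * B + Y) * (1 / real t) \<le> (\<bar>X\<bar> + 2 * B + Y) * (real max_shift / real c)"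
  proof (rule mult_left_mono)
    have "0 \<le> B" using h[OF st_in_chain[of s 0]] by (rule order_trans[OF abs_ge_zero])
    moreover have "0 \<le> Y" by (simp add: Y_def sum_nonneg)
    ultimately show "0 \<le> \<bar>X\<bar> + 2 * B + Y" by simp
  qed (use inverse_passage_le[OF c, of s] in \<open>simp add: t_def\<close>)
  ultimately show ?thesis
    unfolding t_def[symmetric] X_def[symmetric] Y_def[symmetric] by linarith
qed

end

lemma lim_sqrt_over_n: "(\<lambda>n. sqrt (real n) / real n) \<longlonglongrightarrow> 0"
proof -
  have "(\<lambda>n. inverse (sqrt (real n))) \<longlonglongrightarrow> 0"
    by (intro tendsto_inverse_0_at_top filterlim_compose[OF sqrt_at_top]
        filterlim_real_sequentially)
  also have "(\<lambda>n. inverse (sqrt (real n))) = (\<lambda>n. sqrt (real n) / real n)"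
    by (simp add: fun_eq_iff inverse_eq_divide sqrt_divide_self_eq)
  finally show ?thesis .
qed

section \<open>Convergence of the expected speed\<close>

context bernoulli_machine
begin

lemma initial_in_chain: "initial \<Gamma> \<in> states \<Gamma> - {sink \<Gamma>}"
  using st_in_chain[of _ 0] by simp

text \<open>The first three terms come from the end of the text and the overshoot, the square root
  from the stopped martingale, \<open>2 * B\<close> from the boundary values of \<open>h\<close>,
  and the last sum from the L2 distances between \<open>g (st s i)\<close> and
  \<open>g (st s N)\<close>. By \<open>passage_le\<close>, \<open>N\<close> exceeds no less than
  every passage time of \<open>c\<close>.\<close>

lemma expected_speed_error:
  assumes harmonic: "\<And>q. q \<in> states \<Gamma> - {sink \<Gamma>} \<Longrightarrow> chain.P g q = g q"
    and h: "\<And>q. q \<in> states \<Gamma> - {sink \<Gamma>} \<Longrightarrow> \<bar>h q\<bar> \<le> B"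
    and g: "\<And>q. q \<in> states \<Gamma> - {sink \<Gamma>} \<Longrightarrow>
      \<bar>expected_shift \<Gamma> \<pi> q - g q - (h q - chain.P h q)\<bar> \<le> \<epsilon>"
    and D: "\<And>q x. q \<in> states \<Gamma> \<Longrightarrow> \<bar>centered_shift h q x\<bar> \<le> D"
    and U: "\<And>i. chain_pow i (\<lambda>q. (g q)\<^sup>2) (initial \<Gamma>) \<le> U"
    and c: "0 < c"
    and k: "k = machine_order \<Gamma> + length w - 1"
    and N: "N = c * card (states \<Gamma>)"
  shows "\<bar>expected_speed a0 w \<Gamma> \<pi> (c + k) - g (initial \<Gamma>)\<bar> \<le>
    (real k + real max_shift + real max_shift * real (machine_order \<Gamma> * card (states \<Gamma>))
       + sqrt (real N * D\<^sup>2) + 2 * B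
       + (\<Sum>i<N. sqrt (U - chain_pow i (\<lambda>q. (g q)\<^sup>2) (initial \<Gamma>)))) * (real max_shift / real c) + \<epsilon>"
proof -
  define n where "n = c + k"
  define L where "L = n + horizon N + 1"
  have "0 < length w" using w_nonempty by simp
  \<comment> \<open>The choice of \<open>k\<close> makes the number of accesses the passage time of
    \<open>c + machine_order \<Gamma>\<close>, and keeps every letter read before the passage of
    \<open>c\<close> inside the text.\<close>
  then have n: "length w \<le> n" "n + 1 - length w = c + machine_order \<Gamma>"
      "c + machine_order \<Gamma> \<le> n"
    unfolding n_def k using c by linarith+
  have L: "horizon N < L" "n \<le> L" by (simp_all add: L_def)
  define b where "b = machine_order \<Gamma> * card (states \<Gamma>)"
  define A where "A = real k + real max_shift + real max_shift * real b"
  define m where "m = real max_shift / real c"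
  define F where "F s = real n / real (passage (c + machine_order \<Gamma>) (cut_text n s))" for s
  define X where "X s = (\<Sum>i<N. of_bool (pos s i < c) * centered_shift h (st s i) (letter s i))" for s
  define Y where "Y s = (\<Sum>i<N. \<bar>g (st s i) - g (st s N)\<bar>)" for s
  define u where "u i = chain_pow i (\<lambda>q. (g q)\<^sup>2) (initial \<Gamma>)" for i
  have m: "0 \<le> m" by (simp add: m_def)
  have F: "\<bar>F s - g (st s N)\<bar> \<le> (A + \<bar>X s\<bar> + 2 * B + Y s) * m + \<epsilon>" for s
  proof -
    define a where "a = passage (c + machine_order \<Gamma>) (cut_text n s)"
    \<comment> \<open>The cut cannot affect the passage of \<open>c\<close>; the remaining
      \<open>machine_order \<Gamma>\<close> positions take at most \<open>b\<close> steps.\<close>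
    have "passage c (cut_text n s) = passage c s"
      using n(3) by (intro passage_cong) (simp add: cut_text_def)
    then have "passage c s \<le> a" "a \<le> passage c s + b"
      using passage_mono[of c "c + machine_order \<Gamma>" "cut_text n s"]
        passage_add_le[of c "machine_order \<Gamma>" "cut_text n s"] by (simp_all add: a_def b_def)
    from speed_position_error[OF c this, of k]
    have "\<bar>F s - real (pos s (passage c s)) / real (passage c s)\<bar> \<le> A * m"
      by (simp add: F_def A_def m_def a_def n_def)
    moreover have "\<bar>real (pos s (passage c s)) / real (passage c s) - g (st s N)\<bar> \<le>
        (\<bar>X s\<bar> + 2 * B + Y s) * m + \<epsilon>"
      unfolding X_def Y_def m_def
      by (rule mean_position_error[OF c _ h g]) (simp_all add: N passage_le)
    moreover have "(A + \<bar>X s\<bar> + 2 * B + Y s) * m + \<epsilon> = A * m + ((\<bar>X s\<bar> + 2 * B + Y s) * m + \<epsilon>)"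
      by (simp add: algebra_simps)
    ultimately show ?thesis by linarith
  qed
  \<comment> \<open>Only the mean of \<open>g (st s N)\<close> matters, and harmonicity keeps it at
    its initial value.\<close>
  have "E L (\<lambda>s. g (st s N)) = g (initial \<Gamma>)"
    using E_st[OF L(1), of g] kernel_pow_fixed[OF harmonic initial_in_chain] by simp
  moreover have "expected_speed a0 w \<Gamma> \<pi> n = E L F"
    using expected_speed_eq[OF n(1) L(2)] unfolding n(2) F_def[abs_def] .
  ultimately have "expected_speed a0 w \<Gamma> \<pi> n - g (initial \<Gamma>) = E L (\<lambda>s. F s - g (st s N))"
    by simp
  then have "\<bar>expected_speed a0 w \<Gamma> \<pi> n - g (initial \<Gamma>)\<bar> \<le> E L (\<lambda>s. \<bar>F s - g (st s N)\<bar>)"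
    by (simp only: abs_E_le)
  also have "\<dots> \<le> E L (\<lambda>s. (A + \<bar>X s\<bar> + 2 * B + Y s) * m + \<epsilon>)"
    by (rule E_mono[OF F])
  also have "\<dots> = (A + E L (\<lambda>s. \<bar>X s\<bar>) + 2 * B + E L Y) * m + \<epsilon>"
    by simp
  also have "\<dots> \<le> (A + sqrt (real N * D\<^sup>2) + 2 * B + (\<Sum>i<N. sqrt (U - u i))) * m + \<epsilon>"
  proof -
    \<comment> \<open>Whether the passage is still ahead at step \<open>i\<close> is decided by the
      letters read before that step.\<close>
    have "adapted i (\<lambda>s. of_bool (pos s i < c) :: real)" for i
      by (rule adaptedI) (metis hist_determines(2) order_refl)
    then have "E L (\<lambda>s. (X s)\<^sup>2) \<le> real N * D\<^sup>2"
      unfolding X_def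
      using E_martingale_sum_sq[where c = "\<lambda>i s. of_bool (pos s i < c)" and d = "centered_shift h",
          OF sum_centered_shift D _ _ L(1)]
      by simp
    then have "E L (\<lambda>s. \<bar>X s\<bar>) \<le> sqrt (real N * D\<^sup>2)"
      using E_abs_le_sqrt[of L X] by (meson order_trans real_sqrt_le_mono)
    moreover have "E L Y \<le> (\<Sum>i<N. sqrt (U - u i))"
    proof -
      have "E L (\<lambda>s. \<bar>g (st s i) - g (st s N)\<bar>) \<le> sqrt (U - u i)" if "i < N" for i
      proof -
        have "E L (\<lambda>s. (g (st s i) - g (st s N))\<^sup>2) \<le> U - u i"
          using E_harmonic_diff[OF harmonic, of i N L] that L(1) U[of N] by (simp add: u_def)
        then show ?thesis
          using E_abs_le_sqrt[of L "\<lambda>s. g (st s i) - g (st s N)"]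
          by (meson order_trans real_sqrt_le_mono)
      qed
      then show ?thesis
        unfolding Y_def by (subst Bochner_Integration.integral_sum) (auto intro!: sum_mono)
    qed
    ultimately show ?thesis by (intro add_right_mono mult_right_mono m) linarith
  qed
  finally show ?thesis
    by (simp add: n_def A_def b_def m_def u_def)
qed

text \<open>The second moments of the martingale increase, since their differences are means of
  squares, and they are bounded because the chain has finitely many states.\<close>

lemma harmonic_square_limit:
  assumes "\<And>q. q \<in> states \<Gamma> - {sink \<Gamma>} \<Longrightarrow> chain.P g q = g q"
  obtains U where "\<And>i. chain_pow i (\<lambda>q. (g q)\<^sup>2) (initial \<Gamma>) \<le> U"
    and "(\<lambda>i. chain_pow i (\<lambda>q. (g q)\<^sup>2) (initial \<Gamma>)) \<longlonglongrightarrow> U"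
proof -
  let ?u = "\<lambda>i. chain_pow i (\<lambda>q. (g q)\<^sup>2) (initial \<Gamma>)"
  have "?u i \<le> ?u (Suc i)" for i
  proof -
    have "0 \<le> E (horizon (Suc i) + 1) (\<lambda>s. (g (st s i) - g (st s (Suc i)))\<^sup>2)"
      by (rule Bochner_Integration.integral_nonneg) simp
    also have "\<dots> = ?u (Suc i) - ?u i"
      by (rule E_harmonic_diff[OF assms]) simp_all
    finally show ?thesis by simp
  qed
  then have "incseq ?u" by (rule incseq_SucI)
  moreover obtain B where "\<And>q. q \<in> states \<Gamma> - {sink \<Gamma>} \<Longrightarrow> \<bar>(g q)\<^sup>2\<bar> \<le> B"
    using chain.bounded_on_states[of "\<lambda>q. (g q)\<^sup>2"] by blast
  then have "?u i \<le> B" for i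
    using chain.abs_kernel_pow_le[of "\<lambda>q. (g q)\<^sup>2" B, OF _ initial_in_chain] by (meson abs_le_D1)
  ultimately show ?thesis
    using incseq_convergent[of ?u B] that by metis
qed

lemma expected_speed_tendsto:
  assumes harmonic: "\<And>q. q \<in> states \<Gamma> - {sink \<Gamma>} \<Longrightarrow> chain.P g q = g q"
    and approx: "\<And>\<epsilon>. \<epsilon> > 0 \<Longrightarrow> \<exists>h. \<forall>q\<in>states \<Gamma> - {sink \<Gamma>}.
      \<bar>expected_shift \<Gamma> \<pi> q - g q - (h q - chain.P h q)\<bar> \<le> \<epsilon>"
  shows "expected_speed a0 w \<Gamma> \<pi> \<longlonglongrightarrow> g (initial \<Gamma>)"
proof -
  define k where "k = machine_order \<Gamma> + length w - 1"
  define C where "C = card (states \<Gamma>)"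
  have C: "0 < C" using finite_states initial_in by (auto simp: C_def card_gt_0_iff)
  obtain U where U: "\<And>i. chain_pow i (\<lambda>q. (g q)\<^sup>2) (initial \<Gamma>) \<le> U"
    and lim_U: "(\<lambda>i. chain_pow i (\<lambda>q. (g q)\<^sup>2) (initial \<Gamma>)) \<longlonglongrightarrow> U"
    using harmonic_square_limit[OF harmonic] by blast
  define v where "v i = sqrt (U - chain_pow i (\<lambda>q. (g q)\<^sup>2) (initial \<Gamma>))" for i
  have "v \<longlonglongrightarrow> sqrt (U - U)"
    unfolding v_def by (intro tendsto_intros lim_U)
  then have "(\<lambda>n. (\<Sum>i<n. v i) / real n) \<longlonglongrightarrow> 0" by (intro cesaro_null) simp
  moreover have "strict_mono (\<lambda>c. c * C)" using C by (simp add: strict_mono_def)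
  ultimately have lim_v: "(\<lambda>c. (\<Sum>i<c * C. v i) / real (c * C)) \<longlonglongrightarrow> 0"
    by (auto dest: LIMSEQ_subseq_LIMSEQ simp: o_def)
  have "(\<lambda>c. expected_speed a0 w \<Gamma> \<pi> (c + k)) \<longlonglongrightarrow> g (initial \<Gamma>)"
  proof (rule tendstoI)
    fix e :: real
    assume e: "e > 0"
    then obtain h where h: "\<And>q. q \<in> states \<Gamma> - {sink \<Gamma>} \<Longrightarrow>
        \<bar>expected_shift \<Gamma> \<pi> q - g q - (h q - chain.P h q)\<bar> \<le> e / 2"
      using approx[of "e / 2"] by auto
    obtain B where B: "\<And>q. q \<in> states \<Gamma> - {sink \<Gamma>} \<Longrightarrow> \<bar>h q\<bar> \<le> B"
      using chain.bounded_on_states[of h] by blast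
    define D where "D = (\<Sum>q\<in>states \<Gamma>. \<Sum>x\<in>UNIV. \<bar>centered_shift h q x\<bar>)"
    have D: "\<bar>centered_shift h q x\<bar> \<le> D" if "q \<in> states \<Gamma>" for q x
      unfolding D_def
      using member_le_sum[of x UNIV "\<lambda>x. \<bar>centered_shift h q x\<bar>"]
        member_le_sum[of q "states \<Gamma>" "\<lambda>q. \<Sum>x\<in>UNIV. \<bar>centered_shift h q x\<bar>"] that
      by (simp add: finite_states sum_nonneg)
    define A where "A = real k + real max_shift
      + real max_shift * real (machine_order \<Gamma> * card (states \<Gamma>)) + 2 * B"
    define R where "R c = (A + sqrt (real (c * C) * D\<^sup>2) + (\<Sum>i<c * C. v i))
      * (real max_shift / real c)" for c
    \<comment> \<open>The three summands are O(1/c), O(1/sqrt c) and a Cesaro mean of the null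
      sequence \<open>v\<close>, taken along the multiples of \<open>C\<close>.\<close>
    have R: "R = (\<lambda>c. (A / real c + sqrt (real C * D\<^sup>2) * (sqrt (real c) / real c)
        + real C * ((\<Sum>i<c * C. v i) / real (c * C))) * real max_shift)"
    proof
      show "R c = (A / real c + sqrt (real C * D\<^sup>2) * (sqrt (real c) / real c)
          + real C * ((\<Sum>i<c * C. v i) / real (c * C))) * real max_shift" for c
        using C by (cases "c = 0") (simp_all add: R_def field_simps real_sqrt_mult)
    qed
    have "R \<longlonglongrightarrow> (0 + sqrt (real C * D\<^sup>2) * 0 + real C * 0) * real max_shift"
      unfolding R by (intro tendsto_intros lim_const_over_n lim_sqrt_over_n lim_v)
    then have "R \<longlonglongrightarrow> 0" by simp
    then have "\<forall>\<^sub>F c in sequentially. R c < e / 2"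
      by (rule order_tendstoD) (use e in simp)
    moreover have "\<forall>\<^sub>F c in sequentially. (0 :: nat) < c" by (rule eventually_gt_at_top)
    ultimately show
      "\<forall>\<^sub>F c in sequentially. dist (expected_speed a0 w \<Gamma> \<pi> (c + k)) (g (initial \<Gamma>)) < e"
    proof eventually_elim
      case (elim c)
      have "\<bar>expected_speed a0 w \<Gamma> \<pi> (c + k) - g (initial \<Gamma>)\<bar> \<le> R c + e / 2"
        using expected_speed_error[OF harmonic B h D U elim(2) k_def refl]
        by (simp add: R_def A_def v_def C_def add_ac)
      then show ?case using elim(1) by (simp add: dist_real_def)
    qed
  qed
  then show ?thesis by (rule LIMSEQ_offset)
qed

end

section \<open>Expected visits\<close>

definition paths :: "'q set \<Rightarrow> nat \<Rightarrow> 'q list set" where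
  "paths S k = {v. length v = k \<and> set v \<subseteq> S}"

lemma paths_0: "paths S 0 = {[]}"
  by (auto simp: paths_def)

lemma paths_Suc: "paths S (Suc k) = (\<lambda>(q, v). q # v) ` (S \<times> paths S k)"
  by (force simp: paths_def length_Suc_conv)

lemma sum_paths_Suc: "(\<Sum>v\<in>paths S (Suc k). F v) = (\<Sum>q\<in>S. \<Sum>v\<in>paths S k. F (q # v))"
  unfolding paths_Suc sum.cartesian_product
  by (subst sum.reindex) (auto simp: inj_on_def o_def split_def)

lemma path_prob_singleton: "path_prob q0 T [q] = of_bool (q = q0)"
  by (simp add: path_prob_def)

lemma path_prob_Cons:
  assumes "v \<noteq> []"
  shows "path_prob q0 T (q # v) = of_bool (q = q0) * T q (hd v) * path_prob (hd v) T v"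
proof -
  obtain n where "length v = Suc n" using assms by (cases v) auto
  then show ?thesis
    using assms
    by (simp add: path_prob_def prod.lessThan_Suc_shift hd_conv_nth del: prod.lessThan_Suc)
qed

section \<open>First-step analysis of expected visits\<close>

context substochastic_kernel
begin

text \<open>A path from \<open>q0\<close> is split after its first state. The sum over
  \<open>q\<close> collapses to \<open>hd v\<close>, as \<open>path_prob q T v\<close> vanishes for
  every other \<open>q\<close>.\<close>

lemma sum_path_prob_Suc:
  assumes "q0 \<in> S" "0 < k"
  shows "(\<Sum>v\<in>paths S (Suc k). path_prob q0 T v * F v) =
    (\<Sum>q\<in>S. T q0 q * (\<Sum>v\<in>paths S k. path_prob q T v * F (q0 # v)))"
proof -
  have "(\<Sum>v\<in>paths S (Suc k). path_prob q0 T v * F v) =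
      (\<Sum>q\<in>S. \<Sum>v\<in>paths S k. path_prob q0 T (q # v) * F (q # v))"
    by (rule sum_paths_Suc)
  also have "\<dots> = (\<Sum>q\<in>S. if q = q0 then
      (\<Sum>v\<in>paths S k. path_prob q0 T (q # v) * F (q # v)) else 0)"
  proof (rule sum.cong)
    show "(\<Sum>v\<in>paths S k. path_prob q0 T (q # v) * F (q # v)) = (if q = q0 then
        (\<Sum>v\<in>paths S k. path_prob q0 T (q # v) * F (q # v)) else 0)" if "q \<in> S" for q
      by (simp add: path_prob_def)
  qed simp
  also have "\<dots> = (\<Sum>v\<in>paths S k. path_prob q0 T (q0 # v) * F (q0 # v))"
    using assms(1) finite_states by simp
  also have "\<dots> = (\<Sum>v\<in>paths S k. \<Sum>q\<in>S. T q0 q * (path_prob q T v * F (q0 # v)))"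
  proof (rule sum.cong)
    fix v
    assume v: "v \<in> paths S k"
    then have "v \<noteq> []" using assms(2) by (auto simp: paths_def)
    then have hd: "hd v \<in> S" using v by (auto simp: paths_def)
    have "(\<Sum>q\<in>S. T q0 q * (path_prob q T v * F (q0 # v))) =
        (\<Sum>q\<in>S. if q = hd v then T q0 q * (path_prob q T v * F (q0 # v)) else 0)"
      by (intro sum.cong) (auto simp: path_prob_def)
    also have "\<dots> = T q0 (hd v) * (path_prob (hd v) T v * F (q0 # v))"
      using hd finite_states by simp
    finally show "path_prob q0 T (q0 # v) * F (q0 # v) =
        (\<Sum>q\<in>S. T q0 q * (path_prob q T v * F (q0 # v)))"
      using \<open>v \<noteq> []\<close> by (simp add: path_prob_Cons)
  qed simp
  also have "\<dots> = (\<Sum>q\<in>S. T q0 q * (\<Sum>v\<in>paths S k. path_prob q T v * F (q0 # v)))"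
    unfolding sum_distrib_left by (rule sum.swap)
  finally show ?thesis .
qed

lemma card_visits_Cons:
  "real (card {i. i < Suc (length v) \<and> (q0 # v) ! i = q}) =
    of_bool (q0 = q) + real (card {i. i < length v \<and> v ! i = q})"
proof -
  have card: "real (card {i. i < n \<and> u ! i = q}) = (\<Sum>i<n. of_bool (u ! i = q))" for u n
    by (simp add: Int_def lessThan_def flip: of_nat_sum)
  show ?thesis
    unfolding card sum.lessThan_Suc_shift by simp
qed

text \<open>A visit at index 0 is weighted by the mass of all continuations, which must be 1. Hence
  the closed set \<open>S0\<close> with full rows: rows of smaller mass may exist outside it, but
  paths from \<open>q0\<close> reach them with weight 0.\<close>

lemma expected_visits_eq_sum:
  assumes S0: "S0 \<subseteq> S" "\<And>q q'. q \<in> S0 \<Longrightarrow> q' \<in> S \<Longrightarrow> T q q' \<noteq> 0 \<Longrightarrow> q' \<in> S0"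
    and row: "\<And>q. q \<in> S0 \<Longrightarrow> (\<Sum>q'\<in>S. T q q') = 1"
    and q0: "q0 \<in> S0"
  shows "expected_visits S q0 T k q = (\<Sum>i<k. kernel_pow S T i (\<lambda>q'. of_bool (q' = q)) q0)"
proof -
  have step: "(\<Sum>q'\<in>S. T q0 q' * F q') = (\<Sum>q'\<in>S. T q0 q' * G q')"
    if "q0 \<in> S0" "\<And>q'. q' \<in> S0 \<Longrightarrow> F q' = G q'" for q0 F G
  proof (intro sum.cong refl)
    fix q'
    assume "q' \<in> S"
    then show "T q0 q' * F q' = T q0 q' * G q'"
      using S0(2)[of q0 q'] that by (cases "T q0 q' = 0") auto
  qed
  have mass: "(\<Sum>v\<in>paths S (Suc k). path_prob q0 T v) = 1" if "q0 \<in> S0" for k q0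
    using that
  proof (induction k arbitrary: q0)
    case 0
    then have "q0 \<in> S" using S0(1) by blast
    then show ?case
      using finite_states by (simp add: sum_paths_Suc paths_0 path_prob_singleton of_bool_def)
  next
    case (Suc k)
    then have "q0 \<in> S" using S0(1) by blast
    then have "(\<Sum>v\<in>paths S (Suc (Suc k)). path_prob q0 T v) =
        (\<Sum>q\<in>S. T q0 q * (\<Sum>v\<in>paths S (Suc k). path_prob q T v))"
      using sum_path_prob_Suc[of q0 "Suc k" "\<lambda>_. 1"] by simp
    also have "\<dots> = (\<Sum>q\<in>S. T q0 q * 1)"
      by (rule step[OF Suc.prems Suc.IH])
    finally show ?case using row[OF Suc.prems] by simp
  qed
  have visits: "expected_visits S q0 T k q =
      (\<Sum>v\<in>paths S k. path_prob q0 T v * real (card {i. i < length v \<and> v ! i = q}))" for k q0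
    unfolding expected_visits_def paths_def by (intro sum.cong) auto
  have "expected_visits S q0 T (Suc k) q = of_bool (q0 = q) +
      (\<Sum>q'\<in>S. T q0 q' * expected_visits S q' T k q)" if "q0 \<in> S0" for k q0
  proof (cases k)
    case 0
    have "q0 \<in> S" using that S0(1) by blast
    have "expected_visits S q0 T (Suc 0) q =
        (\<Sum>q'\<in>S. if q' = q0 then of_bool (q0 = q) else 0)"
      unfolding visits sum_paths_Suc paths_0 card_visits_Cons list.size
      by (intro sum.cong) (auto simp: path_prob_singleton card_visits_Cons[of "[]", simplified])
    then show ?thesis
      using \<open>q0 \<in> S\<close> finite_states 0 by (simp add: visits paths_0)
  next
    case (Suc l)
    have "q0 \<in> S" using that S0(1) by blast
    have "expected_visits S q0 T (Suc k) q = (\<Sum>q'\<in>S. T q0 q' *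
        (\<Sum>v\<in>paths S k. path_prob q' T v * (of_bool (q0 = q)
          + real (card {i. i < length v \<and> v ! i = q}))))"
      unfolding visits using \<open>q0 \<in> S\<close> Suc
      by (subst sum_path_prob_Suc) (simp_all only: list.size add_Suc_right add_0_right
          card_visits_Cons zero_less_Suc)
    also have "\<dots> = (\<Sum>q'\<in>S. T q0 q' * (of_bool (q0 = q) * (\<Sum>v\<in>paths S k. path_prob q' T v)
        + expected_visits S q' T k q))"
      by (simp add: visits distrib_left sum.distrib sum_distrib_left mult_ac)
    also have "\<dots> = (\<Sum>q'\<in>S. T q0 q' * (of_bool (q0 = q) + expected_visits S q' T k q))"
      by (rule step[OF that]) (simp add: mass Suc)
    also have "\<dots> = of_bool (q0 = q) * (\<Sum>q'\<in>S. T q0 q') +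
        (\<Sum>q'\<in>S. T q0 q' * expected_visits S q' T k q)"
      by (simp add: distrib_left sum.distrib sum_distrib_left mult_ac)
    finally show ?thesis by (simp add: row[OF that])
  qed
  note visits_Suc = this
  show ?thesis
    using q0
  proof (induction k arbitrary: q0)
    case 0
    then show ?case by (simp add: visits paths_0)
  next
    case (Suc k)
    have "(\<Sum>q'\<in>S. T q0 q' * expected_visits S q' T k q) =
        P (\<lambda>q'. \<Sum>i<k. kernel_pow S T i (\<lambda>q'. of_bool (q' = q)) q') q0"
      by (subst kernel_op_def) (rule step[OF Suc.prems Suc.IH])
    then show ?case
      by (simp add: visits_Suc[OF Suc.prems] kernel_op_sum sum.lessThan_Suc_shift del: sum.lessThan_Suc)
  qed
qed

end

section \<open>States visited with positive probability\<close>

context bernoulli_machine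
begin

text \<open>The states met on such texts form the closed set with full rows that
  \<open>expected_visits_eq_sum\<close> asks for.\<close>

definition "typical s \<longleftrightarrow> (\<forall>u. pmf \<pi> (s u) \<noteq> 0)"

lemma initial_typical: "\<exists>s. typical s"
proof -
  obtain x where "pmf \<pi> x \<noteq> 0" using set_pmf_not_empty[of \<pi>] by (auto simp: set_pmf_eq)
  then have "typical (\<lambda>_. x)" by (simp add: typical_def)
  then show ?thesis by blast
qed

text \<open>The letter actually read is admissible, because the run avoids the sink, and it has
  positive probability.\<close>

lemma live_typical:
  assumes "typical s"
  shows "live (st s i) \<noteq> 0"
proof -
  have "pmf \<pi> (letter s i) > 0"
    using assms by (simp add: typical_def letter_def pmf_pos)
  moreover have "trans_fun \<Gamma> (st s i) (letter s i) \<noteq> sink \<Gamma>"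
    using st_not_sink[of s "Suc i"] by simp
  then have "pmf \<pi> (letter s i) \<le> live (st s i)"
    unfolding live_def by (intro member_le_sum) auto
  ultimately show ?thesis by simp
qed

text \<open>At a repeated access \<open>x\<close> must be the letter of the text. At a fresh one,
  overwriting that letter by \<open>x\<close> keeps the earlier run and the positivity of all
  letters.\<close>

lemma typical_step:
  assumes s: "typical s" and x: "pmf \<pi> x \<noteq> 0" "trans_fun \<Gamma> (st s i) x \<noteq> sink \<Gamma>"
  shows "\<exists>s' i'. typical s' \<and> st s' i' = trans_fun \<Gamma> (st s i) x"
proof (cases "access s i \<in> access s ` {..<i}")
  case True
  then have "x = letter s i"
    using x(2) trans_st_eq_sink_iff[OF st_not_sink, of s i x] by simp
  then have "st s (Suc i) = trans_fun \<Gamma> (st s i) x" by simp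
  then show ?thesis using s by blast
next
  case False
  define s' where "s' = s(access s i := x)"
  have agree: "s' (access s j) = s (access s j)" if "j < i" for j
    using False that unfolding s'_def by (metis fun_upd_other imageI lessThan_iff)
  have "st s' i = st s i" "access s' i = access s i"
    using history_cong(1,3)[of i s' s i, OF agree] by simp_all
  then have "st s' (Suc i) = trans_fun \<Gamma> (st s i) x"
    by (simp add: letter_def s'_def)
  moreover have "typical s'" using s x(1) by (simp add: typical_def s'_def)
  ultimately show ?thesis by blast
qed

text \<open>Frequencies become ergodic averages of indicators, so the mean ergodic theorem gives
  their convergence.\<close>

lemma chain_mean_visits_eq_avg:
  "chain_mean_visits \<Gamma> \<pi> q k =
    kernel_avg (states \<Gamma> - {sink \<Gamma>}) (chain_trans \<Gamma> \<pi>) (\<lambda>q'. of_bool (q' = q)) k (initial \<Gamma>)"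
proof -
  let ?S = "states \<Gamma> - {sink \<Gamma>}"
  let ?V = "{st s i | s i. typical s}"
  have "expected_visits ?S (initial \<Gamma>) (chain_trans \<Gamma> \<pi>) k q =
      (\<Sum>i<k. chain_pow i (\<lambda>q'. of_bool (q' = q)) (initial \<Gamma>))"
  proof (rule chain.expected_visits_eq_sum[where ?S0.0 = ?V])
    show "?V \<subseteq> ?S" by (auto simp: st_in st_not_sink)
    show "initial \<Gamma> \<in> ?V"
      using initial_typical st_0 by (metis (mono_tags, lifting) mem_Collect_eq)
    show "(\<Sum>q'\<in>?S. chain_trans \<Gamma> \<pi> q q') = 1" if "q \<in> ?V" for q
    proof -
      have "live q \<noteq> 0" "q \<in> states \<Gamma>" using that by (auto simp: live_typical st_in)
      then show ?thesis
        using sum_letter_prob_trans[of q "\<lambda>_. 1"] by (simp add: kernel_op_def sum_letter_prob)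
    qed
    fix q q'
    assume q: "q \<in> ?V" "q' \<in> ?S" "chain_trans \<Gamma> \<pi> q q' \<noteq> 0"
    then have "(\<Sum>x | trans_fun \<Gamma> q x = q'. pmf \<pi> x) \<noteq> 0" by (auto simp: chain_trans_def)
    then obtain x where x: "trans_fun \<Gamma> q x = q'" "pmf \<pi> x \<noteq> 0"
      by (metis (mono_tags, lifting) mem_Collect_eq sum.neutral)
    from q(1) obtain s i where s: "q = st s i" "typical s" by auto
    have "\<exists>s' i'. typical s' \<and> st s' i' = trans_fun \<Gamma> (st s i) x"
      by (rule typical_step) (use s x q(2) in auto)
    then show "q' \<in> ?V" unfolding mem_Collect_eq using s(1) x(1) by metis
  qed
  then show ?thesis
    by (simp add: chain_mean_visits_def mean_visits_def kernel_avg_def)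
qed

end

theorem theorem5:
  fixes w :: "'a::finite list" and a0 :: 'a
    and \<Gamma> :: "('q, 'a) machine" and \<pi> :: "'a pmf"
  assumes "matching_machine w \<Gamma>"
    and "all_reachable a0 w \<Gamma>"
    and "standard a0 w \<Gamma>"
    and "valid a0 w \<Gamma>"
  shows "(\<forall>q\<in>states \<Gamma>. convergent (chain_mean_visits \<Gamma> \<pi> q)) \<and>
    convergent (expected_speed a0 w \<Gamma> \<pi>) \<and>
    asymptotic_speed a0 w \<Gamma> \<pi> = (\<Sum>q\<in>states \<Gamma>. state_freq \<Gamma> \<pi> q * expected_shift \<Gamma> \<pi> q)"
proof -
  interpret bernoulli_machine w a0 \<Gamma> \<pi>
    by unfold_locales (use assms in auto)
  let ?S = "states \<Gamma> - {sink \<Gamma>}" and ?T = "chain_trans \<Gamma> \<pi>"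
  obtain g where harmonic: "\<And>q. q \<in> ?S \<Longrightarrow> chain.P g q = g q"
    and avg: "\<And>q. q \<in> ?S \<Longrightarrow> (\<lambda>k. kernel_avg ?S ?T (expected_shift \<Gamma> \<pi>) k q) \<longlonglongrightarrow> g q"
    and approx: "\<And>\<epsilon>. \<epsilon> > 0 \<Longrightarrow>
      \<exists>h. \<forall>q\<in>?S. \<bar>expected_shift \<Gamma> \<pi> q - g q - (h q - chain.P h q)\<bar> \<le> \<epsilon>"
    using chain.mean_ergodic[of "expected_shift \<Gamma> \<pi>"] by blast
  have speed: "expected_speed a0 w \<Gamma> \<pi> \<longlonglongrightarrow> g (initial \<Gamma>)"
    by (rule expected_speed_tendsto[OF harmonic approx])
  have conv: "convergent (chain_mean_visits \<Gamma> \<pi> q)" for q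
    using chain.kernel_avg_convergent[OF initial_in_chain]
    by (simp add: chain_mean_visits_eq_avg[abs_def])
  then have freq: "chain_mean_visits \<Gamma> \<pi> q \<longlonglongrightarrow> state_freq \<Gamma> \<pi> q" for q
    by (simp add: convergent_LIMSEQ_iff chain_mean_visits_def state_freq_def limit_freq_def)
  \<comment> \<open>By linearity, weighting the visit averages by the expected shift gives the
    ergodic average of the expected shift, with limit \<open>g (initial \<Gamma>)\<close>. The sink
    may be included because its indicator vanishes on the chain.\<close>
  have avg_eq: "(\<Sum>q\<in>states \<Gamma>. chain_mean_visits \<Gamma> \<pi> q k * expected_shift \<Gamma> \<pi> q) =
      kernel_avg ?S ?T (expected_shift \<Gamma> \<pi>) k (initial \<Gamma>)" for k
  proof -
    have "chain_pow i (expected_shift \<Gamma> \<pi>) (initial \<Gamma>) =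
        chain_pow i (\<lambda>q'. \<Sum>q\<in>states \<Gamma>. expected_shift \<Gamma> \<pi> q * of_bool (q' = q)) (initial \<Gamma>)" for i
      using finite_states
      by (intro kernel_pow_cong initial_in_chain) (simp add: of_bool_def if_distrib cong: if_cong)
    then have "kernel_avg ?S ?T (expected_shift \<Gamma> \<pi>) k (initial \<Gamma>) =
        (\<Sum>i<k. \<Sum>q\<in>states \<Gamma>. expected_shift \<Gamma> \<pi> q
          * chain_pow i (\<lambda>q'. of_bool (q' = q)) (initial \<Gamma>)) / real k"
      by (simp only: kernel_avg_def kernel_pow_sum_cmult)
    also have "\<dots> = (\<Sum>q\<in>states \<Gamma>. chain_mean_visits \<Gamma> \<pi> q k * expected_shift \<Gamma> \<pi> q)"
      unfolding chain_mean_visits_eq_avg kernel_avg_def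
      by (subst sum.swap, subst sum_divide_distrib)
        (simp add: sum_distrib_left[symmetric] mult.commute)
    finally show ?thesis by simp
  qed
  have "(\<lambda>k. \<Sum>q\<in>states \<Gamma>. chain_mean_visits \<Gamma> \<pi> q k * expected_shift \<Gamma> \<pi> q)
      \<longlonglongrightarrow> (\<Sum>q\<in>states \<Gamma>. state_freq \<Gamma> \<pi> q * expected_shift \<Gamma> \<pi> q)"
    by (intro tendsto_intros freq)
  then have "(\<Sum>q\<in>states \<Gamma>. state_freq \<Gamma> \<pi> q * expected_shift \<Gamma> \<pi> q) = g (initial \<Gamma>)"
    unfolding avg_eq by (rule LIMSEQ_unique[OF _ avg[OF initial_in_chain]])
  moreover have "asymptotic_speed a0 w \<Gamma> \<pi> = g (initial \<Gamma>)"
    unfolding asymptotic_speed_def by (rule limI[OF speed])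
  moreover have "convergent (expected_speed a0 w \<Gamma> \<pi>)"
    using speed by (rule convergentI)
  ultimately show ?thesis using conv by simp
qed

end
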